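(* Let $(Z_t)_{t\in\mathbb{Z}}$ be an iid sequence of real-valued random variables with generic element $Z$ which is regularly varying with index $\alpha=2$, $\mathbb{E}[Z]=0$ and $\mathrm{var}(Z)=\infty$. Let $(\psi_j)_{j\ge 0}$ be an absolutely summable sequence of real numbers with $\psi_0=1$, and consider the causal linear process $$X_t=\sum_{j=0}^\infty\psi_j\,Z_{t-j},\qquad t\in\mathbb{Z},$$ with partial sums $S_n=X_1+\cdots+X_n$. Let $X$ be a generic element of $(X_t)$ and let $(a_n)$ and $(a_n^Z)$ be defined by $$n\,\mathbb{P}(|X|>a_n)+\frac{n}{a_n^2}\mathbb{E}\big[X^2\mathbf 1(|X|\le a_n)\big]=1,\qquad n\,\mathbb{P}(|Z|>a_n^Z)+\frac{n}{(a_n^Z)^2}\mathbb{E}\big[Z^2\mathbf 1(|Z|\le a_n^Z)\big]=1 .$$ Then, as $n\to\infty$, $$a_n^{-1}S_n\ \stackrel{d}{\to}\ N(0,\sigma^2),\qquad \sigma^2:=\Big(\sum_{j=0}^\infty\psi_j\Big)^2\Big/\sum_{k=0}^\infty\psi_k^2 ,$$ and $$(a_n^Z)^{-1}S_n\ \stackrel{d}{\to}\ N(0,\widetilde\sigma^2),\qquad \widetilde\sigma^2=\Big(\sum_{j=0}^\infty\psi_j\Big)^2 .$$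
   Context: An iid sequence with generic element $Z$ is regularly varying with index $\alpha=2$ if there exist a slowly varying function $L$ and constants $p_\pm\ge 0$ such that $\mathbb{P}(|Z|>x)=L(x)x^{-2}$ for $x>0$ and $\mathbb{P}(\pm Z>x)/\mathbb{P}(|Z|>x)\to p_\pm$ as $x\to\infty$. The infinite series defining $X_t$ converges almost surely. The sequences $(a_n)$ and $(a_n^Z)$ are uniquely defined by their equations for all sufficiently large $n$. $N(0,0)$ is the point mass at $0$. *)

theory Defs
  imports "HOL-Probability.Probability"
begin

text \<open>Only the values of \<open>L\<close> on the positive half-line matter.\<close>

definition slowly_varying :: "(real \<Rightarrow> real) \<Rightarrow> bool" where
  "slowly_varying L \<longleftrightarrow>
     L \<in> borel_measurable (restrict_space borel {0<..}) \<and>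
     (\<forall>\<^sub>F x in at_top. L x > 0) \<and>
     (\<forall>c>0. ((\<lambda>x. L (c * x) / L x) \<longlongrightarrow> 1) at_top)"

definition regularly_varying_rv :: "'a measure \<Rightarrow> ('a \<Rightarrow> real) \<Rightarrow> real \<Rightarrow> bool" where
  "regularly_varying_rv M Z \<alpha> \<longleftrightarrow>
     (\<exists>L p q. slowly_varying L \<and> p \<ge> 0 \<and> q \<ge> 0 \<and>
        (\<forall>x>0. measure M {\<omega> \<in> space M. \<bar>Z \<omega>\<bar> > x} = L x * x powr (- \<alpha>)) \<and>
        ((\<lambda>x. measure M {\<omega> \<in> space M. Z \<omega> > x} /
              measure M {\<omega> \<in> space M. \<bar>Z \<omega>\<bar> > x}) \<longlongrightarrow> p) at_top \<and>
        ((\<lambda>x. measure M {\<omega> \<in> space M. - Z \<omega> > x} /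
              measure M {\<omega> \<in> space M. \<bar>Z \<omega>\<bar> > x}) \<longlongrightarrow> q) at_top)"

text \<open>
  \<^const>\<open>suminf\<close> takes an unspecified value at outcomes where the series diverges; for the
  processes of interest these form a null set.
\<close>

definition linear_process :: "(nat \<Rightarrow> real) \<Rightarrow> (int \<Rightarrow> 'a \<Rightarrow> real) \<Rightarrow> int \<Rightarrow> 'a \<Rightarrow> real" where
  "linear_process \<psi> Z t \<omega> = (\<Sum>j. \<psi> j * Z (t - int j) \<omega>)"

definition partial_sum :: "(int \<Rightarrow> 'a \<Rightarrow> real) \<Rightarrow> nat \<Rightarrow> 'a \<Rightarrow> real" where
  "partial_sum X n \<omega> = (\<Sum>t=1..int n. X t \<omega>)"

text \<open>
  The defining equation is required for large \<open>n\<close> only: for small \<open>n\<close> it may have no solution,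
  e.g. for \<open>n = 0\<close>.
\<close>

definition normalizing_seq :: "'a measure \<Rightarrow> ('a \<Rightarrow> real) \<Rightarrow> (nat \<Rightarrow> real) \<Rightarrow> bool" where
  "normalizing_seq M Y a \<longleftrightarrow>
     (\<forall>\<^sub>F n in sequentially. a n > 0 \<and>
        real n * measure M {\<omega> \<in> space M. \<bar>Y \<omega>\<bar> > a n} +
        real n / (a n)\<^sup>2 * (\<integral>\<omega>. (Y \<omega>)\<^sup>2 * indicator {y. \<bar>y\<bar> \<le> a n} (Y \<omega>) \<partial>M) = 1)"

text \<open>
  The second parameter is the variance, whereas \<^const>\<open>normal_density\<close> takes the standard
  deviation.
\<close>

definition normal_distribution :: "real \<Rightarrow> real \<Rightarrow> real measure" where
  "normal_distribution m v =
     (if v = 0 then return borel m else density lborel (\<lambda>x. ennreal (normal_density m (sqrt v) x)))"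

end

theory Submission
  imports Defs
begin

text \<open>
  Write \<open>U x = E[min (Z\<^sup>2) (x\<^sup>2)]\<close> for the truncated second moment of the noise. A sequence \<open>a\<close> is
  normalizing for a variable with truncated second moment \<open>u\<close> if and only if, for large \<open>n\<close>, \<open>a n\<close> is positive and
  \<open>n * u (a n) / (a n)\<^sup>2 = 1\<close>. Hence both claims follow from two facts.

  The first is a limit theorem for the partial sums under an arbitrary norming
  (\<open>partial_sum_weak_limit\<close>): if \<open>b n\<close> tends to infinity and \<open>n * U (b n) / (b n)\<^sup>2\<close> tends to \<open>v\<close>, then
  \<open>S\<^sub>n / b n\<close> converges to \<open>N(0, v * \<Psi>\<^sup>2)\<close>, where \<open>\<Psi>\<close> is the sum of the \<open>\<psi> j\<close>. The second is that the truncated second moment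
  of the linear process is asymptotic to \<open>U x\<close> times the sum of the \<open>(\<psi> j)\<^sup>2\<close> (\<open>trunc_moment_linear_process\<close>). For the norming
  \<open>a\<^sub>Z\<close> of the noise \<open>v = 1\<close>, and for the norming \<open>a\<close> of the process the second fact gives
  \<open>v = 1 / (\<Sum>k. (\<psi> k)\<^sup>2)\<close>.

  Everything rests on two estimates that say that the noise has hardly any mass beyond \<open>x\<close> on the scale
  of \<open>U\<close>: both \<open>x\<^sup>2 * P (\<bar>Z\<bar> > x)\<close> and \<open>x * E[max 0 (\<bar>Z\<bar> - x)]\<close> are \<open>o(U x)\<close>. The first is Karamata's
  theorem at index 2 (\<open>regularly_varying_tail_negligible\<close>), the second follows from it (\<open>excess_negligible\<close>).

  For the limit theorem, clip the noise at \<open>b n\<close>. Expand the characteristic function of the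
  noise, with the clipped variable in the quadratic term; the two estimates control the error, and the
  limit for the iid sums follows. The partial sum of the process minus \<open>\<Psi>\<close> times the iid sum is a series over the lags \<open>j\<close>
  of \<open>\<psi> j\<close> times the difference between the sum over a block of \<open>n\<close> times and over its shift by \<open>j\<close>. These
  blocks differ in only \<open>min j n\<close> times on either side, so the series is \<open>o(b n)\<close> in \<open>L\<^sup>1\<close>.

  For the truncated moment of the process, clip each noise variable at \<open>x\<close> before filtering. The
  filtered clipped noise has second moment \<open>U x * (\<Sum>k. (\<psi> k)\<^sup>2)\<close> up to a bounded term, and its square differs from the
  square of the clipped process by \<open>o(U x)\<close> in \<open>L\<^sup>1\<close>, again by the two estimates. Finally \<open>U x\<close> tends to infinity
  because the variance is infinite, which absorbs the bounded term.
\<close>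

section \<open>Clipping, tails and truncated second moments\<close>

definition clip :: "real \<Rightarrow> real \<Rightarrow> real" where
  "clip x y = max (- x) (min x y)"

definition tail_prob :: "'a measure \<Rightarrow> ('a \<Rightarrow> real) \<Rightarrow> real \<Rightarrow> real" where
  "tail_prob M Y x = measure M {\<omega> \<in> space M. \<bar>Y \<omega>\<bar> > x}"

text \<open>
  Clipping instead of cutting off replaces the usual \<open>E[Y\<^sup>2; \<bar>Y\<bar> \<le> x]\<close> by
  \<open>E[min (Y\<^sup>2) (x\<^sup>2)]\<close>, in which the tail term of a normalizing equation is already included and which
  is Lipschitz in \<open>Y\<close>.
\<close>
definition trunc_moment :: "'a measure \<Rightarrow> ('a \<Rightarrow> real) \<Rightarrow> real \<Rightarrow> real" where
  "trunc_moment M Y x = (\<integral>\<omega>. (clip x (Y \<omega>))\<^sup>2 \<partial>M)"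

text \<open>
  For \<open>x \<ge> 0\<close> this is the mean of \<open>max 0 (\<bar>Y\<bar> - x)\<close>.
\<close>
definition excess :: "'a measure \<Rightarrow> ('a \<Rightarrow> real) \<Rightarrow> real \<Rightarrow> real" where
  "excess M Y x = (\<integral>\<omega>. \<bar>Y \<omega> - clip x (Y \<omega>)\<bar> \<partial>M)"

lemma clip_measurable [measurable]: "clip x \<in> borel_measurable borel"
  unfolding clip_def by measurable

lemma abs_clip: "0 \<le> x \<Longrightarrow> \<bar>clip x y\<bar> = min \<bar>y\<bar> x"
  by (auto simp: clip_def)

lemma clip_sq: "0 \<le> x \<Longrightarrow> (clip x y)\<^sup>2 = (min \<bar>y\<bar> x)\<^sup>2"
  by (metis abs_clip power2_abs)

lemma clip_sq_le: "0 \<le> x \<Longrightarrow> (clip x y)\<^sup>2 \<le> x\<^sup>2"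
  by (simp add: clip_sq power_mono)

lemma abs_diff_clip: "0 \<le> x \<Longrightarrow> \<bar>y - clip x y\<bar> = max 0 (\<bar>y\<bar> - x)"
  by (auto simp: clip_def)

lemma abs_clip_diff_le: "\<bar>clip x y - clip x z\<bar> \<le> \<bar>y - z\<bar>"
  by (auto simp: clip_def)

context prob_space
begin

lemma tail_prob_eq_expectation:
  assumes [measurable]: "Y \<in> borel_measurable M"
  shows "tail_prob M Y x = expectation (\<lambda>\<omega>. indicat_real {y. \<bar>y\<bar> > x} (Y \<omega>))"
proof -
  have "expectation (\<lambda>\<omega>. indicat_real {y. \<bar>y\<bar> > x} (Y \<omega>))
      = expectation (indicat_real {\<omega> \<in> space M. \<bar>Y \<omega>\<bar> > x})"
    by (intro Bochner_Integration.integral_cong) (auto split: split_indicator)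
  then show ?thesis by (simp add: tail_prob_def)
qed

lemma integrable_tail_indicator [simp]:
  fixes Y :: "'a \<Rightarrow> real"
  assumes [measurable]: "Y \<in> borel_measurable M"
  shows "integrable M (\<lambda>\<omega>. indicator {y. \<bar>y\<bar> > x} (Y \<omega>) :: real)"
proof -
  have [measurable]: "{y::real. \<bar>y\<bar> > x} \<in> sets borel" by measurable
  show ?thesis by (rule integrable_const_bound[where B=1]) (auto split: split_indicator)
qed

lemma integrable_clip:
  assumes [measurable]: "Y \<in> borel_measurable M" and "0 \<le> x"
  shows "integrable M (\<lambda>\<omega>. clip x (Y \<omega>))"
  by (rule integrable_const_bound[where B=x]) (use assms in \<open>auto simp: abs_clip\<close>)

lemma integrable_clip_sq:
  assumes [measurable]: "Y \<in> borel_measurable M" and "0 \<le> x"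
  shows "integrable M (\<lambda>\<omega>. (clip x (Y \<omega>))\<^sup>2)"
  by (rule integrable_const_bound[where B="x\<^sup>2"]) (use assms in \<open>auto simp: clip_sq_le\<close>)

lemma integrable_excess:
  assumes "integrable M Y" "0 \<le> x"
  shows "integrable M (\<lambda>\<omega>. \<bar>Y \<omega> - clip x (Y \<omega>)\<bar>)"
  using assms integrable_clip[of Y x] by (intro integrable_abs Bochner_Integration.integrable_diff) auto

lemma trunc_moment_nonneg: "0 \<le> trunc_moment M Y x"
  by (simp add: trunc_moment_def)

lemma tail_prob_nonneg: "0 \<le> tail_prob M Y x"
  by (simp add: tail_prob_def)

lemma excess_nonneg: "0 \<le> excess M Y x"
  by (simp add: excess_def)

text \<open>
  With this identity the equation that defines a normalizing sequence becomes
  \<open>n * U (a n) = (a n)\<^sup>2\<close>, where \<open>U\<close> is the truncated second moment.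
\<close>
lemma trunc_moment_eq:
  assumes [measurable]: "Y \<in> borel_measurable M" and "0 \<le> x"
  shows "trunc_moment M Y x =
    (\<integral>\<omega>. (Y \<omega>)\<^sup>2 * indicator {y. \<bar>y\<bar> \<le> x} (Y \<omega>) \<partial>M) + x\<^sup>2 * tail_prob M Y x"
proof -
  have "(Y \<omega>)\<^sup>2 * indicator {y. \<bar>y\<bar> \<le> x} (Y \<omega>) =
     (clip x (Y \<omega>))\<^sup>2 - x\<^sup>2 * indicator {y. \<bar>y\<bar> > x} (Y \<omega>)" for \<omega>
    using assms(2) by (auto simp: clip_sq min_def split: split_indicator)
  then show ?thesis
    using assms(2) by (simp add: trunc_moment_def tail_prob_eq_expectation integrable_clip_sq)
qed

lemma trunc_moment_mono:
  assumes "Y \<in> borel_measurable M" "0 \<le> x" "x \<le> y"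
  shows "trunc_moment M Y x \<le> trunc_moment M Y y"
  unfolding trunc_moment_def using assms
  by (intro integral_mono integrable_clip_sq) (auto simp: clip_sq intro!: power_mono)

text \<open>
  The quotient is the mean of \<open>(min (\<bar>Y\<bar> / x) 1)\<^sup>2\<close>, which decreases in \<open>x\<close>.
\<close>
lemma trunc_moment_div_sq_antimono:
  assumes "Y \<in> borel_measurable M" "0 < x" "x \<le> y"
  shows "trunc_moment M Y y / y\<^sup>2 \<le> trunc_moment M Y x / x\<^sup>2"
proof -
  have "(clip y z)\<^sup>2 / y\<^sup>2 \<le> (clip x z)\<^sup>2 / x\<^sup>2" for z
  proof -
    have "min \<bar>z\<bar> y / y \<le> min \<bar>z\<bar> x / x"
      using assms by (auto simp: min_def field_simps intro: mult_right_mono)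
    moreover have "0 \<le> min \<bar>z\<bar> y / y" using assms by simp
    ultimately have "(min \<bar>z\<bar> y / y)\<^sup>2 \<le> (min \<bar>z\<bar> x / x)\<^sup>2" by (rule power_mono)
    then show ?thesis using assms by (simp add: clip_sq power_divide)
  qed
  then have "(\<integral>\<omega>. (clip y (Y \<omega>))\<^sup>2 / y\<^sup>2 \<partial>M) \<le> (\<integral>\<omega>. (clip x (Y \<omega>))\<^sup>2 / x\<^sup>2 \<partial>M)"
    using assms by (intro integral_mono) (auto intro!: integrable_clip_sq)
  then show ?thesis by (simp add: trunc_moment_def)
qed

text \<open>
  Outcomes with \<open>\<bar>Y\<bar> > x\<close> contribute \<open>x\<^sup>2 - (x / 2)\<^sup>2\<close> to the difference. Iterated over the scales
  \<open>x / 2 ^ k\<close> this bounds the truncated moment from below by a sum of tails.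
\<close>
lemma trunc_moment_half:
  assumes [measurable]: "Y \<in> borel_measurable M" and "0 \<le> x"
  shows "3 / 4 * (x\<^sup>2 * tail_prob M Y x) \<le> trunc_moment M Y x - trunc_moment M Y (x / 2)"
proof -
  have "3 / 4 * x\<^sup>2 * indicator {y. \<bar>y\<bar> > x} z \<le> (clip x z)\<^sup>2 - (clip (x/2) z)\<^sup>2" for z
  proof (cases "\<bar>z\<bar> > x")
    case True
    then have "(clip x z)\<^sup>2 = x\<^sup>2" "(clip (x / 2) z)\<^sup>2 = x\<^sup>2 / 4"
      using assms(2) by (simp_all add: clip_sq min_def power_divide)
    then show ?thesis using True by simp
  next
    case False
    have "(min \<bar>z\<bar> (x/2))\<^sup>2 \<le> (min \<bar>z\<bar> x)\<^sup>2" using assms(2) by (intro power_mono) auto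
    then show ?thesis using False assms(2) by (simp add: clip_sq)
  qed
  then have "(\<integral>\<omega>. 3 / 4 * x\<^sup>2 * indicator {y. \<bar>y\<bar> > x} (Y \<omega>) \<partial>M)
      \<le> (\<integral>\<omega>. (clip x (Y \<omega>))\<^sup>2 - (clip (x/2) (Y \<omega>))\<^sup>2 \<partial>M)"
    using assms(2) by (intro integral_mono) (auto intro!: integrable_clip_sq)
  then show ?thesis using assms(2)
    by (simp add: trunc_moment_def tail_prob_eq_expectation integrable_clip_sq)
qed

text \<open>
  Clipping at \<open>x\<close> and at \<open>2 * x\<close> differ only where \<open>\<bar>Y\<bar> > x\<close>. So a tail that is small compared with
  the truncated moment makes the truncated moment slowly varying; the next lemma plays the same role
  for the excess.
\<close>
lemma trunc_moment_double:
  assumes [measurable]: "Y \<in> borel_measurable M" and "0 \<le> x"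
  shows "trunc_moment M Y (2 * x) - trunc_moment M Y x \<le> 4 * (x\<^sup>2 * tail_prob M Y x)"
proof -
  have "(clip (2 * x) z)\<^sup>2 - (clip x z)\<^sup>2 \<le> 4 * x\<^sup>2 * indicator {y. \<bar>y\<bar> > x} z" for z
  proof (cases "\<bar>z\<bar> > x")
    case True
    have "(clip (2 * x) z)\<^sup>2 \<le> (2 * x)\<^sup>2" using assms(2) by (intro clip_sq_le) auto
    then show ?thesis using True by (simp add: power_mult_distrib) (smt (verit) zero_le_power2)
  next
    case False
    then show ?thesis using assms(2) by (simp add: clip_sq)
  qed
  then have "(\<integral>\<omega>. (clip (2 * x) (Y \<omega>))\<^sup>2 - (clip x (Y \<omega>))\<^sup>2 \<partial>M)
      \<le> (\<integral>\<omega>. 4 * x\<^sup>2 * indicator {y. \<bar>y\<bar> > x} (Y \<omega>) \<partial>M)"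
    using assms(2) by (intro integral_mono) (auto intro!: integrable_clip_sq)
  then show ?thesis using assms(2)
    by (simp add: trunc_moment_def tail_prob_eq_expectation integrable_clip_sq)
qed

lemma excess_double:
  assumes "integrable M Y" and "0 \<le> x"
  shows "excess M Y x - excess M Y (2 * x) \<le> x * tail_prob M Y x"
proof -
  have [measurable]: "Y \<in> borel_measurable M" using assms(1) by simp
  have "\<bar>z - clip x z\<bar> - \<bar>z - clip (2 * x) z\<bar> \<le> x * indicator {y. \<bar>y\<bar> > x} z" for z
    using assms(2) by (auto simp: abs_diff_clip split: split_indicator)
  then have "(\<integral>\<omega>. \<bar>Y \<omega> - clip x (Y \<omega>)\<bar> - \<bar>Y \<omega> - clip (2 * x) (Y \<omega>)\<bar> \<partial>M)
      \<le> (\<integral>\<omega>. x * indicator {y. \<bar>y\<bar> > x} (Y \<omega>) \<partial>M)"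
    using assms by (intro integral_mono Bochner_Integration.integrable_diff integrable_excess) auto
  then show ?thesis using assms
    by (simp add: excess_def tail_prob_eq_expectation integrable_excess)
qed

lemma excess_tendsto_0:
  assumes "integrable M Y"
  shows "(excess M Y \<longlongrightarrow> 0) at_top"
proof -
  have [measurable]: "Y \<in> borel_measurable M" using assms(1) by simp
  have "((\<lambda>x. \<integral>\<omega>. \<bar>Y \<omega> - clip x (Y \<omega>)\<bar> \<partial>M) \<longlongrightarrow> (\<integral>\<omega>. 0 \<partial>M)) at_top"
  proof (rule integral_dominated_convergence_at_top[where w="\<lambda>\<omega>. \<bar>Y \<omega>\<bar>"])
    show "\<forall>\<^sub>F x in at_top. AE \<omega> in M. norm \<bar>Y \<omega> - clip x (Y \<omega>)\<bar> \<le> \<bar>Y \<omega>\<bar>"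
      using eventually_ge_at_top[of 0] by eventually_elim (auto simp: abs_diff_clip)
    have "((\<lambda>x. \<bar>Y \<omega> - clip x (Y \<omega>)\<bar>) \<longlongrightarrow> 0) at_top" for \<omega>
      by (rule tendsto_eventually)
        (use eventually_ge_at_top[of "\<bar>Y \<omega>\<bar>"] in \<open>eventually_elim, auto simp: clip_def\<close>)
    then show "AE \<omega> in M. ((\<lambda>x. \<bar>Y \<omega> - clip x (Y \<omega>)\<bar>) \<longlongrightarrow> 0) at_top" by simp
  qed (use assms in auto)
  then show ?thesis by (simp add: excess_def[abs_def])
qed

lemma trunc_moment_at_top:
  assumes [measurable]: "Y \<in> borel_measurable M"
    and inf: "(\<integral>\<^sup>+\<omega>. ennreal ((Y \<omega>)\<^sup>2) \<partial>M) = \<infinity>"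
  shows "filterlim (trunc_moment M Y) at_top at_top"
proof -
  have "(\<lambda>n. \<integral>\<^sup>+\<omega>. ennreal ((clip (real n) (Y \<omega>))\<^sup>2) \<partial>M)
      \<longlonglongrightarrow> (\<integral>\<^sup>+\<omega>. ennreal ((Y \<omega>)\<^sup>2) \<partial>M)"
  proof (rule nn_integral_LIMSEQ)
    show "incseq (\<lambda>n \<omega>. ennreal ((clip (real n) (Y \<omega>))\<^sup>2))"
      by (auto simp: incseq_def le_fun_def clip_sq intro!: ennreal_leI power_mono)
    fix \<omega>
    show "(\<lambda>n. ennreal ((clip (real n) (Y \<omega>))\<^sup>2)) \<longlonglongrightarrow> ennreal ((Y \<omega>)\<^sup>2)"
    proof (rule tendsto_eventually)
      obtain N where "\<bar>Y \<omega>\<bar> \<le> real N" using real_arch_simple by blast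
      show "\<forall>\<^sub>F n in sequentially. ennreal ((clip (real n) (Y \<omega>))\<^sup>2) = ennreal ((Y \<omega>)\<^sup>2)"
        using eventually_ge_at_top[of N]
      proof eventually_elim
        case (elim n)
        then have "\<bar>Y \<omega>\<bar> \<le> real n" using \<open>\<bar>Y \<omega>\<bar> \<le> real N\<close> by linarith
        then show ?case by (auto simp: clip_def)
      qed
    qed
  qed auto
  moreover have "(\<integral>\<^sup>+\<omega>. ennreal ((clip (real n) (Y \<omega>))\<^sup>2) \<partial>M) = ennreal (trunc_moment M Y (real n))" for n
    unfolding trunc_moment_def by (intro nn_integral_eq_integral integrable_clip_sq) auto
  ultimately have *: "(\<lambda>n. ennreal (trunc_moment M Y (real n))) \<longlonglongrightarrow> \<infinity>" using inf by simp
  show ?thesis unfolding filterlim_at_top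
  proof
    fix K :: real
    have "\<forall>\<^sub>F n in sequentially. ennreal K < ennreal (trunc_moment M Y (real n))"
      by (rule order_tendstoD(1)[OF *]) simp
    then obtain n where "ennreal K < ennreal (trunc_moment M Y (real n))"
      by (auto simp: eventually_sequentially)
    then have n: "K \<le> trunc_moment M Y (real n)"
      by (metis ennreal_leI leD linorder_le_cases)
    show "\<forall>\<^sub>F x in at_top. K \<le> trunc_moment M Y x"
      using eventually_ge_at_top[of "real n"]
    proof eventually_elim
      case (elim x)
      then show ?case using trunc_moment_mono[of Y "real n" x] n by auto
    qed
  qed
qed

text \<open>
  This is the part of Karamata's theorem that matters at the critical index 2. The function
  \<open>l x = x\<^sup>2 * P (\<bar>Y\<bar> > x)\<close> is slowly varying, so the dyadic lower bound for the truncated moment is a sum of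
  \<open>N\<close> terms that are all comparable with \<open>l x\<close>, and \<open>N\<close> is arbitrary. For each \<open>N\<close> only
  finitely many scales occur, so the pointwise convergence in the definition of slow variation suffices.
\<close>
lemma regularly_varying_tail_negligible:
  assumes [measurable]: "Y \<in> borel_measurable M" and rv: "regularly_varying_rv M Y 2"
  shows "((\<lambda>x. x\<^sup>2 * tail_prob M Y x / trunc_moment M Y x) \<longlongrightarrow> 0) at_top"
proof -
  define l where "l x = x\<^sup>2 * tail_prob M Y x" for x
  obtain L where L: "slowly_varying L"
    and G: "\<And>x. x > 0 \<Longrightarrow> tail_prob M Y x = L x * x powr (-2)"
    using rv unfolding regularly_varying_rv_def tail_prob_def by auto
  have lL: "l x = L x" if "x > 0" for x
    using that by (simp add: l_def G powr_minus powr_numeral)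
  have half: "\<forall>\<^sub>F x in at_top. l x / 2 \<le> l (x / 2 ^ k)" for k :: nat
  proof -
    have "((\<lambda>x. L (1 / 2 ^ k * x) / L x) \<longlongrightarrow> 1) at_top"
      using L by (simp add: slowly_varying_def del: times_divide_eq_left)
    then have "\<forall>\<^sub>F x in at_top. 1 / 2 < L (1 / 2 ^ k * x) / L x"
      by (rule order_tendstoD) simp
    moreover have "\<forall>\<^sub>F x in at_top. 0 < L x" using L by (simp add: slowly_varying_def)
    ultimately show ?thesis using eventually_gt_at_top[of 0]
      by eventually_elim (simp add: lL field_simps)
  qed
  have sum: "trunc_moment M Y x \<ge> 3 / 4 * (\<Sum>k<N. l (x / 2 ^ k))" if "0 \<le> x" for x and N :: nat
  proof -
    have "trunc_moment M Y x \<ge> trunc_moment M Y (x / 2 ^ N) + 3 / 4 * (\<Sum>k<N. l (x / 2 ^ k))"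
    proof (induction N)
      case (Suc N)
      then show ?case using trunc_moment_half[of Y "x / 2 ^ N"] \<open>0 \<le> x\<close>
        by (simp add: l_def algebra_simps)
    qed simp
    then show ?thesis using trunc_moment_nonneg[of Y "x / 2 ^ N"] by linarith
  qed
  show ?thesis unfolding l_def[symmetric]
  proof (rule tendstoI)
    fix e :: real assume "e > 0"
    \<comment> \<open>The dyadic bound gives \<open>3 / 4 * N * (l x / 2)\<close>, which must exceed \<open>l x / e\<close>.\<close>
    obtain N :: nat where "8 / (3 * e) < N" using reals_Archimedean2 by blast
    then have N: "8 < 3 * e * N" using \<open>e > 0\<close> by (simp add: field_simps)
    then have "N > 0" by (cases N) auto
    have "\<forall>\<^sub>F x in at_top. \<forall>k\<in>{..<N}. l x / 2 \<le> l (x / 2 ^ k)"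
      using half by (simp add: eventually_ball_finite)
    then show "\<forall>\<^sub>F x in at_top. dist (l x / trunc_moment M Y x) 0 < e"
      using eventually_gt_at_top[of 0]
    proof eventually_elim
      case (elim x)
      have l0: "0 \<le> l x" by (simp add: l_def tail_prob_nonneg)
      show ?case
      proof (cases "l x = 0")
        case True then show ?thesis using \<open>e > 0\<close> by simp
      next
        case False
        then have lp: "l x > 0" using l0 by simp
        have "(\<Sum>k<N. l x / 2) \<le> (\<Sum>k<N. l (x / 2 ^ k))" using elim by (intro sum_mono) auto
        then have U: "3 / 8 * N * l x \<le> trunc_moment M Y x" using sum[of x N] elim by simp
        moreover have "0 < 3 / 8 * N * l x" using lp \<open>N > 0\<close> by simp
        ultimately have Upos: "trunc_moment M Y x > 0" by linarith
        have "8 * l x < 3 * e * N * l x" using N lp by simp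
        then have "l x < e * (3 / 8 * N * l x)" by simp
        also have "\<dots> \<le> e * trunc_moment M Y x" using U \<open>e > 0\<close> by simp
        finally show ?thesis using Upos lp by (simp add: field_simps)
      qed
    qed
  qed
qed

end

section \<open>Variables in the domain of attraction of the normal law\<close>

text \<open>
  The tail condition is Levy's criterion for the domain of attraction of the normal law. It is the form
  in which regular variation of index 2 enters the limit theorem.
\<close>
locale negligible_tail_rv = prob_space +
  fixes Y :: "'a \<Rightarrow> real"
  assumes integrable: "integrable M Y"
    and second_moment: "(\<integral>\<^sup>+\<omega>. ennreal ((Y \<omega>)\<^sup>2) \<partial>M) = \<infinity>"
    and tail_negligible: "((\<lambda>x. x\<^sup>2 * tail_prob M Y x / trunc_moment M Y x) \<longlongrightarrow> 0) at_top"
begin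

abbreviation "U \<equiv> trunc_moment M Y"
abbreviation "G \<equiv> tail_prob M Y"
abbreviation "V \<equiv> excess M Y"

lemma measurable_Y [measurable]: "Y \<in> borel_measurable M"
  using integrable by simp

lemma U_at_top: "filterlim U at_top at_top"
  by (rule trunc_moment_at_top[OF _ second_moment]) simp

lemma eventually_U_pos: "\<forall>\<^sub>F x in at_top. 0 < U x"
  using U_at_top by (simp add: filterlim_at_top_dense)

text \<open>
  The excess telescopes over the scales \<open>2 ^ k * x\<close> into terms at most \<open>y * G y\<close> with \<open>y = 2 ^ k * x\<close>.
  Each of these is a small multiple of \<open>U y / y\<close>, and \<open>U y / y\<close> decreases geometrically in \<open>k\<close>, as doubling
  the argument multiplies \<open>U\<close> by at most \<open>3 / 2\<close> eventually; so the sum is a small multiple of \<open>U x / x\<close>.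
\<close>
lemma excess_negligible: "((\<lambda>x. x * V x / U x) \<longlongrightarrow> 0) at_top"
proof (rule tendstoI)
  fix e0 :: real assume "e0 > 0"
  define e where "e = min 1 e0 / 2"
  have e: "0 < e" "e \<le> 1/2" "e < e0" using \<open>e0 > 0\<close> by (auto simp: e_def min_def)
  have "\<forall>\<^sub>F x in at_top. x\<^sup>2 * G x / U x < e / 4"
    using e by (intro order_tendstoD(2)[OF tail_negligible]) auto
  then have "\<forall>\<^sub>F x in at_top. 0 < x \<and> 0 < U x \<and> x\<^sup>2 * G x \<le> e / 4 * U x"
    using eventually_U_pos eventually_gt_at_top[of 0]
    by eventually_elim (auto simp: field_simps)
  then obtain x0 where x0: "\<And>x. x \<ge> x0 \<Longrightarrow> 0 < x \<and> 0 < U x \<and> x\<^sup>2 * G x \<le> e / 4 * U x"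
    by (auto simp: eventually_at_top_linorder)
  have xG: "x * G x \<le> e / 4 * (U x / x)" if "x \<ge> x0" for x
    using x0[OF that] by (simp add: field_simps power2_eq_square)
  have ratio: "U (2 * x) / (2 * x) \<le> 3 / 4 * (U x / x)" if "x \<ge> x0" for x
  proof -
    have "U (2 * x) \<le> U x + 4 * (x\<^sup>2 * G x)"
      using trunc_moment_double[of Y x] x0[OF that] by simp
    also have "\<dots> \<le> U x + e * U x" using x0[OF that] by simp
    also have "\<dots> \<le> U x + 1/2 * U x"
      using e x0[OF that] by (intro add_left_mono mult_right_mono) auto
    finally show ?thesis using x0[OF that] by (simp add: field_simps)
  qed
  \<comment> \<open>The error \<open>e\<close> reproduces itself: \<open>e / 4\<close> comes from the tail at \<open>x\<close> and \<open>3 / 4 * e\<close> from \<open>2 * x\<close>.\<close>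
  have step: "V x \<le> V (2 ^ k * x) + e * (U x / x)" if "x \<ge> x0" for x k
    using that
  proof (induction k arbitrary: x)
    case 0
    then show ?case using e x0[OF 0] by simp
  next
    case (Suc k)
    have "2 * x \<ge> x0" using x0[OF Suc.prems] Suc.prems by simp
    have "V x \<le> x * G x + V (2 * x)"
      using excess_double[OF integrable, of x] x0[OF Suc.prems] by simp
    also have "V (2 * x) \<le> V (2 ^ k * (2 * x)) + e * (U (2 * x) / (2 * x))"
      by (rule Suc.IH) fact
    also have "e * (U (2 * x) / (2 * x)) \<le> e * (3 / 4 * (U x / x))"
      using ratio[OF Suc.prems] e by (intro mult_left_mono) auto
    finally have "V x \<le> x * G x + (V (2 ^ k * (2 * x)) + e * (3 / 4 * (U x / x)))" by simp
    moreover define q where "q = e * (U x / x)"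
    ultimately have "V x \<le> x * G x + V (2 ^ k * (2 * x)) + 3 / 4 * q" by simp
    moreover have "x * G x \<le> q / 4" using xG[OF Suc.prems] by (simp add: q_def)
    ultimately have "V x \<le> V (2 ^ k * (2 * x)) + q" by linarith
    moreover have "2 ^ Suc k * x = 2 ^ k * (2 * x)" by simp
    ultimately show ?case by (simp only: q_def)
  qed
  have bound: "V x \<le> e * (U x / x)" if "x \<ge> x0" for x
  proof -
    have "filterlim (\<lambda>k::nat. (2::real) ^ k) at_top sequentially"
      using filterlim_realpow_sequentially_gt1[of "2::real"]
      by (intro filterlim_at_infinity_imp_filterlim_at_top) auto
    then have "filterlim (\<lambda>k::nat. x * 2 ^ k) at_top sequentially"
      using x0[OF that] by (intro filterlim_tendsto_pos_mult_at_top[OF tendsto_const]) auto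
    then have "filterlim (\<lambda>k::nat. 2 ^ k * x) at_top sequentially" by (simp add: mult.commute)
    then have "(\<lambda>k. V (2 ^ k * x)) \<longlonglongrightarrow> 0"
      by (rule filterlim_compose[OF excess_tendsto_0[OF integrable]])
    then have "(\<lambda>k. V (2 ^ k * x) + e * (U x / x)) \<longlonglongrightarrow> 0 + e * (U x / x)"
      by (intro tendsto_intros)
    then show ?thesis using step[OF that] by (auto intro: LIMSEQ_le_const)
  qed
  have *: "x * V x / U x \<le> e" if "x \<ge> x0" for x
    using bound[OF that] x0[OF that] by (simp add: field_simps)
  show "\<forall>\<^sub>F x in at_top. dist (x * V x / U x) 0 < e0"
    using eventually_ge_at_top[of x0]
  proof eventually_elim
    case (elim x)
    then show ?case using *[OF elim] x0[OF elim] e excess_nonneg[of Y x]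
      by (simp add: abs_mult)
  qed
qed

text \<open>
  Replacing \<open>U (c * x)\<close> by \<open>U x\<close> in the denominator only helps, as \<open>U\<close> is increasing and \<open>c \<le> 1\<close>.
\<close>
lemma scaled_tail_negligible:
  assumes "0 < c" "c \<le> 1"
  shows "((\<lambda>x. x\<^sup>2 * G (c * x) / U x) \<longlongrightarrow> 0) at_top"
proof -
  have "filterlim (\<lambda>x. c * x) at_top at_top"
    using assms by (intro filterlim_tendsto_pos_mult_at_top[OF tendsto_const] filterlim_ident)
  from filterlim_compose[OF tail_negligible this]
  have "((\<lambda>x. (1 / c\<^sup>2) * ((c * x)\<^sup>2 * G (c * x) / U (c * x))) \<longlongrightarrow> (1 / c\<^sup>2) * 0) at_top"
    by (intro tendsto_intros)
  then have lim: "((\<lambda>x. x\<^sup>2 * G (c * x) / U (c * x)) \<longlongrightarrow> 0) at_top"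
    using assms by (simp add: power_mult_distrib)
  have pos: "\<forall>\<^sub>F x in at_top. 0 < U (c * x)"
    by (rule eventually_compose_filterlim[OF eventually_U_pos \<open>filterlim (\<lambda>x. c * x) at_top at_top\<close>])
  show ?thesis
  proof (rule tendsto_sandwich[OF _ _ tendsto_const lim])
    show "\<forall>\<^sub>F x in at_top. 0 \<le> x\<^sup>2 * G (c * x) / U x"
      by (auto intro!: always_eventually divide_nonneg_nonneg mult_nonneg_nonneg tail_prob_nonneg trunc_moment_nonneg)
    show "\<forall>\<^sub>F x in at_top. x\<^sup>2 * G (c * x) / U x \<le> x\<^sup>2 * G (c * x) / U (c * x)"
      using pos eventually_gt_at_top[of 0]
    proof eventually_elim
      case (elim x)
      have "U (c * x) \<le> U x" using assms elim by (intro trunc_moment_mono) (auto simp: mult_le_cancel_right1)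
      then show ?case using elim
        by (intro divide_left_mono) (auto intro!: mult_nonneg_nonneg tail_prob_nonneg)
    qed
  qed
qed

end

section \<open>The characteristic function under norming\<close>

lemma real_distribution_normal:
  assumes "0 \<le> v"
  shows "real_distribution (normal_distribution 0 v)"
proof (cases "v = 0")
  case True
  then show ?thesis
    by (auto simp: normal_distribution_def real_distribution_def real_distribution_axioms_def
        intro: prob_space_return)
next
  case False
  then show ?thesis using assms prob_space_normal_density[of "sqrt v" 0]
    by (auto simp: normal_distribution_def real_distribution_def real_distribution_axioms_def)
qed

text \<open>
  For \<open>v > 0\<close> the law is the image of the standard normal law under multiplication by \<open>sqrt v\<close>.
\<close>
lemma char_normal_distribution:
  assumes "0 \<le> v"
  shows "char (normal_distribution 0 v) t = complex_of_real (exp (- (v * t\<^sup>2) / 2))"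
proof (cases "v = 0")
  case True
  then show ?thesis by (simp add: normal_distribution_def char_def integral_return)
next
  case False
  interpret N: real_distribution std_normal_distribution by (rule real_dist_normal_dist)
  have s: "sqrt v > 0" using False assms by simp
  have "distributed std_normal_distribution lborel (\<lambda>x. x) (normal_density 0 1)"
    by (auto simp: distributed_def distr_id2)
  then have "distributed std_normal_distribution lborel (\<lambda>x. 0 + sqrt v * x)
      (normal_density (0 + sqrt v * 0) (\<bar>sqrt v\<bar> * 1))"
    using s by (intro N.normal_density_affine) auto
  then have "distr std_normal_distribution lborel (\<lambda>x. sqrt v * x) = normal_distribution 0 v"
    using False assms by (simp add: distributed_def normal_distribution_def)
  moreover have "distr std_normal_distribution lborel (\<lambda>x. sqrt v * x)
      = distr std_normal_distribution borel (\<lambda>x. sqrt v * x)"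
    by (rule distr_cong) auto
  ultimately have "char (normal_distribution 0 v) t
      = char (distr std_normal_distribution borel (\<lambda>x. sqrt v * x)) t" by simp
  also have "\<dots> = char std_normal_distribution (t * sqrt v)"
    by (simp add: char_def integral_distr mult.assoc)
  also have "\<dots> = complex_of_real (exp (- (v * t\<^sup>2) / 2))"
    using assms by (simp add: char_std_normal_distribution power_mult_distrib mult.commute)
  finally show ?thesis .
qed

text \<open>
  Compare with \<open>(1 + w / n) ^ n\<close>: in the unit disc the \<open>n\<close>-th power is Lipschitz with constant \<open>n\<close>. The
  sign of \<open>w\<close> keeps \<open>1 + w / n\<close> in the disc.
\<close>
lemma tendsto_power_exp_complex:
  fixes z :: "nat \<Rightarrow> complex"
  assumes z: "\<And>n. cmod (z n) \<le> 1" and lim: "(\<lambda>n. of_nat n * (z n - 1)) \<longlonglongrightarrow> of_real w"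
    and "w \<le> 0"
  shows "(\<lambda>n. z n ^ n) \<longlonglongrightarrow> of_real (exp w)"
proof -
  let ?u = "\<lambda>n. complex_of_real (1 + w / real n)"
  have "(\<lambda>n. of_nat n * (z n - 1) - of_real w) \<longlonglongrightarrow> of_real w - of_real w"
    by (intro tendsto_intros lim)
  then have "(\<lambda>n. cmod (of_nat n * (z n - 1) - of_real w)) \<longlonglongrightarrow> 0"
    using tendsto_norm by fastforce
  moreover have "\<forall>\<^sub>F n in sequentially.
      norm (z n ^ n - ?u n ^ n) \<le> cmod (of_nat n * (z n - 1) - of_real w)"
    using eventually_gt_at_top[of "nat \<lceil>-w\<rceil>"]
  proof eventually_elim
    case (elim n)
    then have n: "- w < real n" "0 < n" by linarith+
    have "cmod (?u n) \<le> 1"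
    proof -
      have "-1 \<le> 1 + w / n" "1 + w / n \<le> 1"
        using n \<open>w \<le> 0\<close> by (auto simp: field_simps)
      then show ?thesis by (simp only: norm_of_real)
    qed
    then have "norm (z n ^ n - ?u n ^ n) \<le> n * norm (z n - ?u n)"
      by (intro norm_power_diff z)
    also have "\<dots> = norm (of_nat n * (z n - ?u n))" by (simp add: norm_mult)
    also have "of_nat n * (z n - ?u n) = of_nat n * (z n - 1) - of_real w"
      using n by (simp add: field_simps)
    finally show ?case .
  qed
  ultimately have 1: "(\<lambda>n. z n ^ n - ?u n ^ n) \<longlonglongrightarrow> 0"
    by (rule Lim_null_comparison[rotated])
  have "(\<lambda>n. complex_of_real ((1 + w / real n) ^ n)) \<longlonglongrightarrow> complex_of_real (exp w)"
    by (intro tendsto_of_real tendsto_exp_limit_sequentially)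
  then have "(\<lambda>n. ?u n ^ n) \<longlonglongrightarrow> of_real (exp w)" by simp
  from tendsto_add[OF 1 this] show ?thesis by simp
qed

text \<open>
  The three terms of the bound belong to three ranges of \<open>z\<close>. For \<open>\<bar>z\<bar> \<le> d * b\<close> the third order
  remainder of the exponential is used, with one factor \<open>\<bar>z\<bar>\<close> estimated by \<open>d * b\<close>, which leaves a second
  moment. Between \<open>d * b\<close> and \<open>b\<close> second order bounds suffice, because only a tail
  probability remains. Beyond \<open>b\<close> the remainder is linear in \<open>\<bar>z\<bar> = b + \<bar>z - clip b z\<bar>\<close>.
\<close>
lemma iexp_clip_approx:
  assumes "0 < d" "d \<le> 1" "0 < b"
  shows "cmod (iexp (s * z) - 1 - \<i> * complex_of_real (s * z) + complex_of_real (s\<^sup>2 * (clip b z)\<^sup>2 / 2))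
    \<le> \<bar>s\<bar> ^ 3 * d * b / 6 * (clip b z)\<^sup>2
      + (s\<^sup>2 * b\<^sup>2 + 2 * \<bar>s\<bar> * b) * indicator {y. \<bar>y\<bar> > d * b} z
      + 2 * \<bar>s\<bar> * \<bar>z - clip b z\<bar>"
    (is "cmod (?e + _) \<le> ?A + ?B + ?C")
proof -
  let ?x = "s * z"
  have pos: "0 \<le> ?A" "0 \<le> ?B" "0 \<le> ?C" using assms by auto
  have db: "d * b \<le> b" using assms by (simp add: mult_left_le_one_le)
  have e1: "cmod (?e + complex_of_real (?x\<^sup>2 / 2)) \<le> \<bar>?x\<bar> ^ 3 / 6"
    using iexp_approx1[of ?x 2] by (simp add: numeral_2_eq_2 fact_numeral power_mult_distrib power3_eq_cube diff_diff_eq numeral_3_eq_3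
        algebra_simps)
  have e2: "cmod ?e \<le> ?x\<^sup>2 / 2"
    using iexp_approx1[of ?x 1] by (simp add: numeral_2_eq_2 diff_diff_eq)
  have e3: "cmod ?e \<le> 2 * \<bar>?x\<bar>"
    using iexp_approx2[of ?x 1] by (simp add: diff_diff_eq)
  consider "\<bar>z\<bar> \<le> d * b" | "d * b < \<bar>z\<bar>" "\<bar>z\<bar> \<le> b" | "b < \<bar>z\<bar>" by linarith
  then show ?thesis
  proof cases
    case 1
    then have c: "clip b z = z" using db by (auto simp: clip_def)
    have "\<bar>z\<bar> ^ 3 = \<bar>z\<bar> * z\<^sup>2"
      by (simp add: power3_eq_cube power2_eq_square mult.assoc)
    then have "\<bar>?x\<bar> ^ 3 / 6 = \<bar>s\<bar> ^ 3 * \<bar>z\<bar> / 6 * z\<^sup>2"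
      by (simp add: abs_mult power_mult_distrib)
    also have "\<dots> \<le> \<bar>s\<bar> ^ 3 * (d * b) / 6 * z\<^sup>2"
      using 1 by (intro mult_right_mono divide_right_mono mult_left_mono) auto
    finally show ?thesis using e1 pos c by (simp add: power_mult_distrib mult.assoc)
  next
    case 2
    then have c: "clip b z = z" by (auto simp: clip_def)
    have "cmod (?e + complex_of_real (s\<^sup>2 * (clip b z)\<^sup>2 / 2)) \<le> cmod ?e + ?x\<^sup>2 / 2"
      using norm_triangle_ineq[of ?e "complex_of_real (s\<^sup>2 * (clip b z)\<^sup>2 / 2)"] c
      by (simp only: norm_of_real) (simp add: power_mult_distrib)
    also have "\<dots> \<le> ?x\<^sup>2" using e2 by simp
    also have "\<dots> \<le> s\<^sup>2 * b\<^sup>2"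
    proof -
      have "\<bar>z\<bar>\<^sup>2 \<le> b\<^sup>2" using 2 by (intro power_mono) auto
      then show ?thesis by (auto simp: power_mult_distrib intro: mult_left_mono)
    qed
    also have "\<dots> \<le> ?B" using 2 assms by simp
    finally show ?thesis using pos by linarith
  next
    case 3
    then have z: "(clip b z)\<^sup>2 = b\<^sup>2" "\<bar>z - clip b z\<bar> = \<bar>z\<bar> - b"
      using assms by (simp_all add: clip_sq abs_diff_clip)
    have "cmod (?e + complex_of_real (s\<^sup>2 * (clip b z)\<^sup>2 / 2)) \<le> cmod ?e + s\<^sup>2 * b\<^sup>2 / 2"
      using norm_triangle_ineq[of ?e "complex_of_real (s\<^sup>2 * (clip b z)\<^sup>2 / 2)"] z
      by (simp only: norm_of_real) simp
    also have "\<dots> \<le> 2 * \<bar>s\<bar> * \<bar>z\<bar> + s\<^sup>2 * b\<^sup>2"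
    proof -
      have "2 * \<bar>?x\<bar> = 2 * \<bar>s\<bar> * \<bar>z\<bar>" "0 \<le> s\<^sup>2 * b\<^sup>2" by (simp_all add: abs_mult)
      then show ?thesis using e3 by linarith
    qed
    also have "\<dots> = ?B + ?C" using 3 db unfolding z(2) by (simp add: algebra_simps)
    finally show ?thesis using pos by linarith
  qed
qed

text \<open>
  The variance of \<open>\<bar>X\<bar>\<close> is nonnegative.
\<close>
lemma (in prob_space) expectation_abs_le_sqrt:
  fixes X :: "'a \<Rightarrow> real"
  assumes [measurable]: "X \<in> borel_measurable M" and "integrable M (\<lambda>\<omega>. (X \<omega>)\<^sup>2)"
  shows "expectation (\<lambda>\<omega>. \<bar>X \<omega>\<bar>) \<le> sqrt (expectation (\<lambda>\<omega>. (X \<omega>)\<^sup>2))"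
proof -
  have "integrable M X" by (rule square_integrable_imp_integrable[OF _ assms(2)]) simp
  then have "0 \<le> expectation (\<lambda>\<omega>. (X \<omega>)\<^sup>2) - (expectation (\<lambda>\<omega>. \<bar>X \<omega>\<bar>))\<^sup>2"
    using variance_positive[of "\<lambda>\<omega>. \<bar>X \<omega>\<bar>"] variance_eq[of "\<lambda>\<omega>. \<bar>X \<omega>\<bar>"] assms(2) by simp
  then show ?thesis by (simp add: real_le_rsqrt)
qed

locale centered_negligible_tail_rv = negligible_tail_rv +
  assumes mean_zero: "expectation Y = 0"
begin

lemma char_approx:
  assumes "0 < d" "d \<le> 1" "0 < b"
  shows "cmod (char (distr M borel Y) s - 1 + complex_of_real (s\<^sup>2 * U b / 2))
    \<le> \<bar>s\<bar> ^ 3 * d * b / 6 * U b + (s\<^sup>2 * b\<^sup>2 + 2 * \<bar>s\<bar> * b) * G (d * b) + 2 * \<bar>s\<bar> * V b"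
proof -
  let ?f = "\<lambda>\<omega>. iexp (s * Y \<omega>) - 1 - \<i> * complex_of_real (s * Y \<omega>) + complex_of_real (s\<^sup>2 * (clip b (Y \<omega>))\<^sup>2 / 2)"
  let ?g = "\<lambda>\<omega>. \<bar>s\<bar> ^ 3 * d * b / 6 * (clip b (Y \<omega>))\<^sup>2
      + (s\<^sup>2 * b\<^sup>2 + 2 * \<bar>s\<bar> * b) * indicator {y. \<bar>y\<bar> > d * b} (Y \<omega>)
      + 2 * \<bar>s\<bar> * \<bar>Y \<omega> - clip b (Y \<omega>)\<bar>"
  note int = integrable integrable_clip_sq[of Y b] integrable_excess[of Y b] \<open>0 < b\<close>
  have i1: "integrable M (\<lambda>\<omega>. iexp (s * Y \<omega>))"
    using integrable_iexp[of "\<lambda>\<omega>. complex_of_real (s * Y \<omega>)"] by simp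
  have i2: "integrable M (\<lambda>\<omega>. \<i> * complex_of_real (s * Y \<omega>))"
    using int by (intro integrable_mult_right integrable_of_real) auto
  have i3: "integrable M (\<lambda>\<omega>. complex_of_real (s\<^sup>2 * (clip b (Y \<omega>))\<^sup>2 / 2))"
    using int by (intro integrable_of_real) auto
  have "(CLINT \<omega>|M. ?f \<omega>) = char (distr M borel Y) s - 1 - \<i> * complex_of_real (s * expectation Y)
      + complex_of_real (s\<^sup>2 * U b / 2)"
  proof -
    have "(CLINT \<omega>|M. ?f \<omega>) = (CLINT \<omega>|M. iexp (s * Y \<omega>)) - (CLINT \<omega>|M. 1)
        - (CLINT \<omega>|M. \<i> * complex_of_real (s * Y \<omega>))
        + (CLINT \<omega>|M. complex_of_real (s\<^sup>2 * (clip b (Y \<omega>))\<^sup>2 / 2))"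
      using i1 i2 i3 by (simp del: of_real_mult of_real_divide of_real_power)
    also have "(CLINT \<omega>|M. iexp (s * Y \<omega>)) = char (distr M borel Y) s"
      by (simp add: char_def integral_distr)
    also have "(CLINT \<omega>|M. (1::complex)) = 1" by (simp add: prob_space)
    also have "(CLINT \<omega>|M. \<i> * complex_of_real (s * Y \<omega>)) = \<i> * complex_of_real (s * expectation Y)"
      using int by (subst integral_mult_right_zero, subst integral_of_real) auto
    also have "(CLINT \<omega>|M. complex_of_real (s\<^sup>2 * (clip b (Y \<omega>))\<^sup>2 / 2)) = complex_of_real (s\<^sup>2 * U b / 2)"
      using int by (subst integral_of_real) (auto simp: trunc_moment_def)
    finally show ?thesis .
  qed
  then have "cmod (char (distr M borel Y) s - 1 + complex_of_real (s\<^sup>2 * U b / 2)) = cmod (CLINT \<omega>|M. ?f \<omega>)"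
    by (simp add: mean_zero)
  also have "\<dots> \<le> (\<integral>\<omega>. cmod (?f \<omega>) \<partial>M)" by (rule integral_norm_bound)
  also have "\<dots> \<le> (\<integral>\<omega>. ?g \<omega> \<partial>M)"
  proof (rule integral_mono)
    show "integrable M (\<lambda>\<omega>. cmod (?f \<omega>))"
      using i1 i2 i3 by (intro integrable_norm Bochner_Integration.integrable_add Bochner_Integration.integrable_diff) auto
    show "integrable M ?g" using int by auto
    show "cmod (?f \<omega>) \<le> ?g \<omega>" for \<omega> using iexp_clip_approx[OF assms, of s "Y \<omega>"] by simp
  qed
  also have "\<dots> = \<bar>s\<bar> ^ 3 * d * b / 6 * U b + (s\<^sup>2 * b\<^sup>2 + 2 * \<bar>s\<bar> * b) * G (d * b) + 2 * \<bar>s\<bar> * V b"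
    using int by (simp add: trunc_moment_def excess_def tail_prob_eq_expectation)
  finally show ?thesis .
qed

end

text \<open>
  The constant \<open>v\<close> allows one limit theorem to serve the norming by the noise, where \<open>v = 1\<close>, and the norming
  by the linear process, where \<open>v\<close> is the inverse of the sum of the squared coefficients.
\<close>
locale norming = negligible_tail_rv +
  fixes b :: "nat \<Rightarrow> real" and v :: real
  assumes b_at_top: "filterlim b at_top sequentially"
    and norming: "(\<lambda>n. real n * U (b n) / (b n)\<^sup>2) \<longlonglongrightarrow> v"
begin

lemma eventually_b_pos: "\<forall>\<^sub>F n in sequentially. 0 < b n"
  using b_at_top by (simp add: filterlim_at_top_dense)

lemma v_nonneg: "0 \<le> v"
  by (rule tendsto_lowerbound[OF norming]) (auto simp: trunc_moment_nonneg intro!: always_eventually)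

text \<open>
  What is negligible compared with \<open>U\<close> is negligible after norming. This and the next two lemmas
  translate the asymptotics at infinity into asymptotics along \<open>b\<close>.
\<close>
lemma norming_negligible:
  assumes "((\<lambda>x. h x / U x) \<longlongrightarrow> 0) at_top"
  shows "(\<lambda>n. real n * h (b n) / (b n)\<^sup>2) \<longlonglongrightarrow> 0"
proof -
  have "(\<lambda>n. h (b n) / U (b n) * (real n * U (b n) / (b n)\<^sup>2)) \<longlonglongrightarrow> 0"
    using tendsto_mult[OF filterlim_compose[OF assms b_at_top] norming] by (simp only: mult_zero_left)
  moreover have "\<forall>\<^sub>F n in sequentially.
      h (b n) / U (b n) * (real n * U (b n) / (b n)\<^sup>2) = real n * h (b n) / (b n)\<^sup>2"
    using eventually_compose_filterlim[OF eventually_U_pos b_at_top] by eventually_elim simp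
  ultimately show ?thesis by (rule Lim_transform_eventually)
qed

lemma norming_excess: "(\<lambda>n. real n * V (b n) / b n) \<longlonglongrightarrow> 0"
proof -
  have "\<forall>\<^sub>F n in sequentially. real n * (b n * V (b n)) / (b n)\<^sup>2 = real n * V (b n) / b n"
    using eventually_b_pos by eventually_elim (simp add: power2_eq_square)
  then show ?thesis using norming_negligible[OF excess_negligible] by (simp add: tendsto_cong)
qed

lemma norming_tail:
  assumes "0 < d" "d \<le> 1"
  shows "(\<lambda>n. real n * G (d * b n)) \<longlonglongrightarrow> 0"
proof -
  have "\<forall>\<^sub>F n in sequentially. real n * ((b n)\<^sup>2 * G (d * b n)) / (b n)\<^sup>2 = real n * G (d * b n)"
    using eventually_b_pos by eventually_elim simp
  then show ?thesis using norming_negligible[OF scaled_tail_negligible[OF assms]] by (simp add: tendsto_cong)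
qed

end

locale centered_norming = norming + centered_negligible_tail_rv
begin

text \<open>
  The quadratic term \<open>n * (t / b n)\<^sup>2 * U (b n) / 2\<close> converges by the norming. In the remainder the
  tail and the excess vanish for every fixed \<open>d\<close>, and the limit superior of the third order term is at most a
  fixed multiple of \<open>d\<close>, so it suffices to choose \<open>d\<close> small before \<open>n\<close> grows.
\<close>
lemma char_scaled_limit:
  "(\<lambda>n. of_nat n * (char (distr M borel Y) (t / b n) - 1)) \<longlonglongrightarrow> of_real (- (v * t\<^sup>2) / 2)"
proof -
  let ?q = "\<lambda>n. real n * U (b n) / (b n)\<^sup>2"
  let ?r = "\<lambda>n. of_nat n * (char (distr M borel Y) (t / b n) - 1) + of_real (t\<^sup>2 * ?q n / 2)"
  have "?r \<longlonglongrightarrow> 0"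
  proof (rule tendstoI)
    fix e :: real assume "0 < e"
    define d where "d = min 1 (e / (\<bar>t\<bar> ^ 3 * v + 1))"
    have v0: "0 \<le> \<bar>t\<bar> ^ 3 * v" using v_nonneg by simp
    have d: "0 < d" "d \<le> 1" using \<open>0 < e\<close> v0 by (auto simp: d_def)
    have de: "\<bar>t\<bar> ^ 3 * d / 6 * v < e"
    proof -
      have "d * (\<bar>t\<bar> ^ 3 * v + 1) \<le> e"
        using v0 by (subst pos_le_divide_eq[symmetric]) (auto simp: d_def)
      moreover have "0 \<le> d * (\<bar>t\<bar> ^ 3 * v)" using v0 d by simp
      ultimately show ?thesis using d by (simp add: algebra_simps)
    qed
    let ?B = "\<lambda>n. \<bar>t\<bar> ^ 3 * d / 6 * ?q n + (t\<^sup>2 + 2 * \<bar>t\<bar>) * (real n * G (d * b n))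
       + 2 * \<bar>t\<bar> * (real n * V (b n) / b n)"
    have "?B \<longlonglongrightarrow> \<bar>t\<bar> ^ 3 * d / 6 * v + (t\<^sup>2 + 2 * \<bar>t\<bar>) * 0 + 2 * \<bar>t\<bar> * 0"
      by (intro tendsto_add tendsto_mult tendsto_const norming norming_excess norming_tail d)
    then have "\<forall>\<^sub>F n in sequentially. ?B n < e" by (rule order_tendstoD) (use de in simp)
    then show "\<forall>\<^sub>F n in sequentially. dist (?r n) 0 < e"
      using eventually_b_pos
    proof eventually_elim
      case (elim n)
      let ?s = "t / b n"
      have "?r n = of_nat n * (char (distr M borel Y) ?s - 1 + complex_of_real (?s\<^sup>2 * U (b n) / 2))"
        by (simp add: algebra_simps power_divide)
      then have "cmod (?r n) = real n * cmod (char (distr M borel Y) ?s - 1 + complex_of_real (?s\<^sup>2 * U (b n) / 2))"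
        by (simp only: norm_mult norm_of_nat)
      also have "\<dots> \<le> real n * (\<bar>?s\<bar> ^ 3 * d * b n / 6 * U (b n)
          + (?s\<^sup>2 * (b n)\<^sup>2 + 2 * \<bar>?s\<bar> * b n) * G (d * b n) + 2 * \<bar>?s\<bar> * V (b n))"
        using char_approx[OF d elim(2), of ?s] by (intro mult_left_mono) auto
      also have "\<dots> = ?B n"
        using elim(2) by (simp add: field_simps power2_eq_square power3_eq_cube)
      finally show ?case using elim(1) by simp
    qed
  qed
  moreover have "(\<lambda>n. complex_of_real (t\<^sup>2 * ?q n / 2)) \<longlonglongrightarrow> of_real (t\<^sup>2 * v / 2)"
    by (intro tendsto_intros norming) simp
  ultimately have "(\<lambda>n. ?r n - of_real (t\<^sup>2 * ?q n / 2)) \<longlonglongrightarrow> 0 - of_real (t\<^sup>2 * v / 2)"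
    by (rule tendsto_diff)
  then show ?thesis by (simp add: mult.commute)
qed

lemma char_scaled_power_limit:
  "(\<lambda>n. char (distr M borel Y) (t / b n) ^ n) \<longlonglongrightarrow> of_real (exp (- (v * t\<^sup>2) / 2))"
proof (rule tendsto_power_exp_complex[OF _ char_scaled_limit])
  interpret D: real_distribution "distr M borel Y" by simp
  show "cmod (char (distr M borel Y) (t / b n)) \<le> 1" for n by (rule D.cmod_char_le_1)
qed (use v_nonneg in simp)

end

section \<open>Series of integrable functions\<close>

lemma AE_summable_if_summable_integral_abs:
  fixes f :: "nat \<Rightarrow> 'a \<Rightarrow> real"
  assumes int: "\<And>j. integrable M (f j)" and sm: "summable (\<lambda>j. \<integral>\<omega>. \<bar>f j \<omega>\<bar> \<partial>M)"
  shows "AE \<omega> in M. summable (\<lambda>j. \<bar>f j \<omega>\<bar>)"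
proof -
  have [measurable]: "f j \<in> borel_measurable M" for j using int[of j] by simp
  have "(\<integral>\<^sup>+\<omega>. (\<Sum>j. ennreal \<bar>f j \<omega>\<bar>) \<partial>M) = (\<Sum>j. \<integral>\<^sup>+\<omega>. ennreal \<bar>f j \<omega>\<bar> \<partial>M)"
    by (rule nn_integral_suminf) simp
  also have "\<dots> = (\<Sum>j. ennreal (\<integral>\<omega>. \<bar>f j \<omega>\<bar> \<partial>M))"
    using int by (intro suminf_cong nn_integral_eq_integral) auto
  also have "\<dots> = ennreal (\<Sum>j. \<integral>\<omega>. \<bar>f j \<omega>\<bar> \<partial>M)"
    by (rule suminf_ennreal2[OF _ sm]) simp
  finally have "(\<integral>\<^sup>+\<omega>. (\<Sum>j. ennreal \<bar>f j \<omega>\<bar>) \<partial>M) \<noteq> \<infinity>" by simp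
  then have "AE \<omega> in M. (\<Sum>j. ennreal \<bar>f j \<omega>\<bar>) \<noteq> \<infinity>"
    by (intro nn_integral_PInf_AE) auto
  then show ?thesis
    by eventually_elim (auto intro!: summable_suminf_not_top)
qed

lemma
  fixes f :: "nat \<Rightarrow> 'a \<Rightarrow> real"
  assumes int: "\<And>j. integrable M (f j)" and sm: "summable (\<lambda>j. \<integral>\<omega>. \<bar>f j \<omega>\<bar> \<partial>M)"
  shows integrable_suminf_L1: "integrable M (\<lambda>\<omega>. \<Sum>j. f j \<omega>)"
    and integral_abs_suminf_le: "(\<integral>\<omega>. \<bar>\<Sum>j. f j \<omega>\<bar> \<partial>M) \<le> (\<Sum>j. \<integral>\<omega>. \<bar>f j \<omega>\<bar> \<partial>M)"
proof -
  note AE = AE_summable_if_summable_integral_abs[OF int sm]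
  show int1: "integrable M (\<lambda>\<omega>. \<Sum>j. f j \<omega>)"
    using AE sm by (intro integrable_suminf int) auto
  have int2: "integrable M (\<lambda>\<omega>. \<Sum>j. \<bar>f j \<omega>\<bar>)"
    using AE sm int by (intro integrable_suminf) auto
  have "(\<integral>\<omega>. \<bar>\<Sum>j. f j \<omega>\<bar> \<partial>M) \<le> (\<integral>\<omega>. (\<Sum>j. \<bar>f j \<omega>\<bar>) \<partial>M)"
    using AE by (intro integral_mono_AE integrable_abs int1 int2) (auto intro: summable_rabs)
  also have "\<dots> = (\<Sum>j. \<integral>\<omega>. \<bar>f j \<omega>\<bar> \<partial>M)"
    using AE sm int by (intro integral_suminf) auto
  finally show "(\<integral>\<omega>. \<bar>\<Sum>j. f j \<omega>\<bar> \<partial>M) \<le> (\<Sum>j. \<integral>\<omega>. \<bar>f j \<omega>\<bar> \<partial>M)" .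
qed

section \<open>Sums over an iid sequence\<close>

locale iid_process = prob_space +
  fixes Z :: "int \<Rightarrow> 'a \<Rightarrow> real"
  assumes indep: "indep_vars (\<lambda>_. borel) Z UNIV"
    and ident: "\<And>t. distr M borel (Z t) = distr M borel (Z 0)"
begin

lemma measurable_Z [measurable]: "Z t \<in> borel_measurable M"
  using indep by (auto simp: indep_vars_def)

lemma expectation_ident:
  fixes g :: "real \<Rightarrow> real"
  assumes [measurable]: "g \<in> borel_measurable borel"
  shows "expectation (\<lambda>\<omega>. g (Z t \<omega>)) = expectation (\<lambda>\<omega>. g (Z 0 \<omega>))"
proof -
  have "expectation (\<lambda>\<omega>. g (Z s \<omega>)) = (\<integral>z. g z \<partial>distr M borel (Z s))" for s
    by (simp add: integral_distr)
  then show ?thesis by (simp only: ident[of t])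
qed

lemma integrable_ident:
  fixes g :: "real \<Rightarrow> real"
  assumes "g \<in> borel_measurable borel"
  shows "integrable M (\<lambda>\<omega>. g (Z t \<omega>)) \<longleftrightarrow> integrable M (\<lambda>\<omega>. g (Z 0 \<omega>))"
proof -
  have "integrable M (\<lambda>\<omega>. g (Z s \<omega>)) \<longleftrightarrow> integrable (distr M borel (Z s)) g" for s
    using assms by (simp add: integrable_distr_eq)
  then show ?thesis by (simp only: ident[of t])
qed

text \<open>
  Off the diagonal all products have mean \<open>m\<^sup>2\<close>; taking \<open>m\<^sup>2\<close> out of the diagonal as well completes
  the double sum to a square. The injection \<open>h\<close> covers both sums over blocks of times and sums over the past
  \<open>0, -1, -2, ...\<close>.
\<close>
lemma expectation_weighted_sum_sq:
  fixes g :: "real \<Rightarrow> real" and w :: "'i \<Rightarrow> real"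
  assumes [measurable]: "g \<in> borel_measurable borel"
    and sq: "integrable M (\<lambda>\<omega>. (g (Z 0 \<omega>))\<^sup>2)"
    and I: "finite I" "inj_on h I"
  defines "m \<equiv> expectation (\<lambda>\<omega>. g (Z 0 \<omega>))"
  shows "expectation (\<lambda>\<omega>. (\<Sum>i\<in>I. w i * g (Z (h i) \<omega>))\<^sup>2)
      = (\<Sum>i\<in>I. (w i)\<^sup>2) * (expectation (\<lambda>\<omega>. (g (Z 0 \<omega>))\<^sup>2) - m\<^sup>2) + (\<Sum>i\<in>I. w i)\<^sup>2 * m\<^sup>2"
    and "integrable M (\<lambda>\<omega>. (\<Sum>i\<in>I. w i * g (Z (h i) \<omega>))\<^sup>2)"
proof -
  define s where "s = expectation (\<lambda>\<omega>. (g (Z 0 \<omega>))\<^sup>2)"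
  have int: "integrable M (\<lambda>\<omega>. g (Z t \<omega>))" for t
  proof -
    have "integrable M (\<lambda>\<omega>. g (Z 0 \<omega>))"
      by (rule square_integrable_imp_integrable[OF _ sq]) simp
    then show ?thesis using integrable_ident[of g t] by simp
  qed
  have sqt: "integrable M (\<lambda>\<omega>. (g (Z t \<omega>))\<^sup>2)" for t
    using sq integrable_ident[of "\<lambda>z. (g z)\<^sup>2" t] by simp
  have prod: "integrable M (\<lambda>\<omega>. g (Z (h i) \<omega>) * g (Z (h j) \<omega>)) \<and>
     expectation (\<lambda>\<omega>. g (Z (h i) \<omega>) * g (Z (h j) \<omega>)) = (if i = j then s else m\<^sup>2)"
    if "i \<in> I" "j \<in> I" for i j
  proof (cases "i = j")
    case True
    then show ?thesis using sqt[of "h j"] expectation_ident[of "\<lambda>z. (g z)\<^sup>2" "h j"]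
      by (simp add: s_def power2_eq_square)
  next
    case False
    then have ne: "h i \<noteq> h j" using that I by (auto simp: inj_on_def)
    have "indep_vars (\<lambda>_. borel) (\<lambda>i \<omega>. g (Z i \<omega>)) {h i, h j}"
      by (rule indep_vars_subset[OF indep_vars_compose2[OF indep]]) auto
    from indep_vars_lebesgue_integral[OF _ this] indep_vars_integrable[OF _ this]
    show ?thesis using ne False int expectation_ident[of g "h i"] expectation_ident[of g "h j"]
      by (simp add: m_def power2_eq_square)
  qed
  have eq: "(\<Sum>i\<in>I. w i * g (Z (h i) \<omega>))\<^sup>2
      = (\<Sum>i\<in>I. \<Sum>j\<in>I. (w i * w j) * (g (Z (h i) \<omega>) * g (Z (h j) \<omega>)))" for \<omega>
    by (simp add: power2_eq_square sum_product mult_ac)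
  show "integrable M (\<lambda>\<omega>. (\<Sum>i\<in>I. w i * g (Z (h i) \<omega>))\<^sup>2)"
    unfolding eq using prod by (intro Bochner_Integration.integrable_sum integrable_mult_right) auto
  have "expectation (\<lambda>\<omega>. (\<Sum>i\<in>I. w i * g (Z (h i) \<omega>))\<^sup>2)
      = (\<Sum>i\<in>I. \<Sum>j\<in>I. (w i * w j) * (if i = j then s else m\<^sup>2))"
    unfolding eq using prod by (simp add: Bochner_Integration.integral_sum)
  also have "\<dots> = (\<Sum>i\<in>I. \<Sum>j\<in>I. (w i * w j) * m\<^sup>2 + (if i = j then (w i)\<^sup>2 * (s - m\<^sup>2) else 0))"
    by (intro sum.cong refl) (auto simp: power2_eq_square algebra_simps)
  also have "\<dots> = (\<Sum>i\<in>I. \<Sum>j\<in>I. w i * w j) * m\<^sup>2 + (\<Sum>i\<in>I. (w i)\<^sup>2 * (s - m\<^sup>2))"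
    using I by (simp only: sum.distrib sum_distrib_right) simp
  also have "\<dots> = (\<Sum>i\<in>I. (w i)\<^sup>2) * (s - m\<^sup>2) + (\<Sum>i\<in>I. w i)\<^sup>2 * m\<^sup>2"
    by (simp only: power2_eq_square[of "\<Sum>i\<in>I. w i"] sum_product) (simp only: sum_distrib_right add.commute)
  finally show "expectation (\<lambda>\<omega>. (\<Sum>i\<in>I. w i * g (Z (h i) \<omega>))\<^sup>2)
      = (\<Sum>i\<in>I. (w i)\<^sup>2) * (expectation (\<lambda>\<omega>. (g (Z 0 \<omega>))\<^sup>2) - m\<^sup>2) + (\<Sum>i\<in>I. w i)\<^sup>2 * m\<^sup>2"
    by (simp add: s_def)
qed

lemma char_sum_iid:
  "char (distr M borel (\<lambda>\<omega>. \<Sum>t\<in>I. Z t \<omega>)) s = char (distr M borel (Z 0)) s ^ card I"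
proof -
  have "char (distr M borel (\<lambda>\<omega>. \<Sum>t\<in>I. Z t \<omega>)) s = (\<Prod>t\<in>I. char (distr M borel (Z t)) s)"
    by (rule char_distr_sum[OF indep_vars_subset[OF indep]]) simp
  also have "\<dots> = (\<Prod>t\<in>I. char (distr M borel (Z 0)) s)" by (intro prod.cong refl) (metis ident)
  finally show ?thesis by simp
qed

end

locale linear_filter =
  fixes \<psi> :: "nat \<Rightarrow> real"
  assumes summable_abs: "summable (\<lambda>j. \<bar>\<psi> j\<bar>)"
begin

lemma summable_\<psi>: "summable \<psi>"
  using summable_abs by (rule summable_rabs_cancel)

end

locale iid_linear_process = iid_process + linear_filter
begin

abbreviation "X \<equiv> linear_process \<psi> Z"

lemma measurable_linear_process [measurable]: "X t \<in> borel_measurable M"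
  unfolding linear_process_def by measurable

lemma measurable_partial_sum [measurable]: "partial_sum X n \<in> borel_measurable M"
  unfolding partial_sum_def by measurable

lemma summable_filtered_expectation:
  fixes h :: "real \<Rightarrow> real"
  assumes [measurable]: "h \<in> borel_measurable borel"
  shows "summable (\<lambda>j. expectation (\<lambda>\<omega>. \<bar>\<psi> j * h (Z (t - int j) \<omega>)\<bar>))"
    and "(\<Sum>j. expectation (\<lambda>\<omega>. \<bar>\<psi> j * h (Z (t - int j) \<omega>)\<bar>))
      = (\<Sum>j. \<bar>\<psi> j\<bar>) * expectation (\<lambda>\<omega>. \<bar>h (Z 0 \<omega>)\<bar>)"
proof -
  have "expectation (\<lambda>\<omega>. \<bar>\<psi> j * h (Z (t - int j) \<omega>)\<bar>) = \<bar>\<psi> j\<bar> * expectation (\<lambda>\<omega>. \<bar>h (Z 0 \<omega>)\<bar>)" for j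
    using expectation_ident[of "\<lambda>z. \<bar>h z\<bar>" "t - int j"] by (simp add: abs_mult)
  then show "summable (\<lambda>j. expectation (\<lambda>\<omega>. \<bar>\<psi> j * h (Z (t - int j) \<omega>)\<bar>))"
    "(\<Sum>j. expectation (\<lambda>\<omega>. \<bar>\<psi> j * h (Z (t - int j) \<omega>)\<bar>))
      = (\<Sum>j. \<bar>\<psi> j\<bar>) * expectation (\<lambda>\<omega>. \<bar>h (Z 0 \<omega>)\<bar>)"
    using summable_abs by (auto simp: suminf_mult2 intro: summable_mult2)
qed

lemma AE_summable_filter:
  fixes h :: "real \<Rightarrow> real"
  assumes [measurable]: "h \<in> borel_measurable borel" and "integrable M (\<lambda>\<omega>. h (Z 0 \<omega>))"
  shows "AE \<omega> in M. summable (\<lambda>j. \<bar>\<psi> j * h (Z (t - int j) \<omega>)\<bar>)"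
proof (rule AE_summable_if_summable_integral_abs)
  show "integrable M (\<lambda>\<omega>. \<psi> j * h (Z (t - int j) \<omega>))" for j
    using assms integrable_ident[of h "t - int j"] by simp
qed (rule summable_filtered_expectation(1)[OF assms(1)])

end

text \<open>
  In this and the following locales \<open>U\<close>, \<open>G\<close> and \<open>V\<close> refer to the generic noise variable.
\<close>
locale heavy_iid_process = iid_process + centered_negligible_tail_rv M "Z 0"
begin

text \<open>
  Although the variance is infinite, sums are controlled in \<open>L\<^sup>1\<close>: the centred clipped parts are
  orthogonal and contribute a standard deviation, while the clipped off parts and the centring constant
  contribute at most their absolute means. The centring constant is bounded by the excess because the mean
  of \<open>Z 0\<close> is 0.
\<close>
lemma expectation_abs_sum_le:
  assumes "finite I" "0 \<le> b"
  shows "expectation (\<lambda>\<omega>. \<bar>\<Sum>i\<in>I. Z i \<omega>\<bar>) \<le> sqrt (real (card I) * U b) + 2 * real (card I) * V b"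
proof -
  define m where "m = expectation (\<lambda>\<omega>. clip b (Z 0 \<omega>))"
  define g where "g z = clip b z - m" for z
  have [measurable]: "g \<in> borel_measurable borel" unfolding g_def[abs_def] by measurable
  note int = integrable integrable_clip[OF measurable_Z, of b] integrable_clip_sq[OF measurable_Z, of b]
    integrable_excess[of "Z 0" b] \<open>0 \<le> b\<close>
  have mean_g: "expectation (\<lambda>\<omega>. g (Z 0 \<omega>)) = 0"
    using int by (simp add: g_def m_def prob_space)
  have g2: "(g z)\<^sup>2 = (clip b z)\<^sup>2 - 2 * m * clip b z + m\<^sup>2" for z
    by (simp add: g_def power2_diff)
  have int_g2: "integrable M (\<lambda>\<omega>. (g (Z 0 \<omega>))\<^sup>2)"
    unfolding g2 using int by auto
  have var_g: "expectation (\<lambda>\<omega>. (g (Z 0 \<omega>))\<^sup>2) \<le> U b"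
  proof -
    have "expectation (\<lambda>\<omega>. (g (Z 0 \<omega>))\<^sup>2) = U b - 2 * m * m + m\<^sup>2"
      unfolding g2 using int by (simp add: trunc_moment_def m_def[symmetric] prob_space)
    then show ?thesis by (simp add: power2_eq_square)
  qed
  have intg: "integrable M (\<lambda>\<omega>. g (Z i \<omega>))" for i
    using int by (simp add: g_def)
  have intZ: "integrable M (Z i)" for i
    using integrable integrable_ident[of "\<lambda>z. z" i] by simp
  have intr: "integrable M (\<lambda>\<omega>. \<bar>Z i \<omega> - clip b (Z i \<omega>)\<bar>)" for i
    using intZ \<open>0 \<le> b\<close> by (rule integrable_excess)
  have m_le: "\<bar>m\<bar> \<le> V b"
  proof -
    have "m = - expectation (\<lambda>\<omega>. Z 0 \<omega> - clip b (Z 0 \<omega>))"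
      using int mean_zero by (simp add: m_def)
    then have "\<bar>m\<bar> = \<bar>expectation (\<lambda>\<omega>. Z 0 \<omega> - clip b (Z 0 \<omega>))\<bar>" by simp
    also have "\<dots> \<le> V b" unfolding excess_def by (rule integral_abs_bound)
    finally show ?thesis .
  qed
  let ?T = "\<lambda>\<omega>. \<Sum>i\<in>I. g (Z i \<omega>)"
  let ?R = "\<lambda>\<omega>. \<Sum>i\<in>I. (\<bar>Z i \<omega> - clip b (Z i \<omega>)\<bar> + V b)"
  have sq: "expectation (\<lambda>\<omega>. (?T \<omega>)\<^sup>2) = real (card I) * expectation (\<lambda>\<omega>. (g (Z 0 \<omega>))\<^sup>2)"
    and intsq: "integrable M (\<lambda>\<omega>. (?T \<omega>)\<^sup>2)"
    using expectation_weighted_sum_sq[of g I "\<lambda>i. i" "\<lambda>_. 1"] int_g2 assms(1) mean_g by auto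
  have "expectation (\<lambda>\<omega>. \<bar>\<Sum>i\<in>I. Z i \<omega>\<bar>) \<le> expectation (\<lambda>\<omega>. \<bar>?T \<omega>\<bar> + ?R \<omega>)"
  proof (rule integral_mono)
    fix \<omega>
    have "(\<Sum>i\<in>I. Z i \<omega>) = ?T \<omega> + (\<Sum>i\<in>I. Z i \<omega> - clip b (Z i \<omega>) + m)"
      by (simp add: g_def sum.distrib[symmetric])
    moreover have "\<bar>\<Sum>i\<in>I. Z i \<omega> - clip b (Z i \<omega>) + m\<bar> \<le> ?R \<omega>"
      using m_le by (intro order_trans[OF sum_abs] sum_mono) linarith
    ultimately show "\<bar>\<Sum>i\<in>I. Z i \<omega>\<bar> \<le> \<bar>?T \<omega>\<bar> + ?R \<omega>" by linarith
  qed (use intg intr intZ in auto)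
  also have "\<dots> = expectation (\<lambda>\<omega>. \<bar>?T \<omega>\<bar>) + expectation ?R"
    using intg intr by (intro Bochner_Integration.integral_add) auto
  also have "expectation ?R = 2 * real (card I) * V b"
  proof -
    have "expectation (\<lambda>\<omega>. \<bar>Z i \<omega> - clip b (Z i \<omega>)\<bar>) = V b" for i
      using expectation_ident[of "\<lambda>z. \<bar>z - clip b z\<bar>" i] by (simp add: excess_def)
    then show ?thesis using intr by (simp add: Bochner_Integration.integral_sum prob_space)
  qed
  also have "expectation (\<lambda>\<omega>. \<bar>?T \<omega>\<bar>) \<le> sqrt (expectation (\<lambda>\<omega>. (?T \<omega>)\<^sup>2))"
    by (rule expectation_abs_le_sqrt[OF _ intsq]) simp
  also have "\<dots> \<le> sqrt (real (card I) * U b)"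
    unfolding sq using var_g by (simp add: mult_left_mono)
  finally show ?thesis by simp
qed

text \<open>
  A block and its shift by \<open>j\<close> differ by two sets of \<open>min j n\<close> times. This uniform bound in both \<open>j\<close> and \<open>n\<close>
  is what makes the series over all shifts converge later.
\<close>
lemma expectation_abs_shifted_sum_le:
  fixes n j :: nat
  assumes "0 \<le> b"
  defines "m \<equiv> real (min j n)"
  shows "expectation (\<lambda>\<omega>. \<bar>(\<Sum>t=1..int n. Z (t - int j) \<omega>) - (\<Sum>t=1..int n. Z t \<omega>)\<bar>)
    \<le> 2 * (sqrt (m * U b) + 2 * m * V b)"
proof -
  let ?A = "{1 - int j..int n - int j}" and ?B = "{1..int n}"
  have AB: "?A - ?B = {1 - int j..min 0 (int n - int j)}"
    "?B - ?A = {max 1 (int n - int j + 1)..int n}" by auto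
  have card: "card (?A - ?B) = min j n" "card (?B - ?A) = min j n"
    unfolding AB by auto
  have intZ: "integrable M (Z i)" for i
    using integrable integrable_ident[of "\<lambda>z. z" i] by simp
  have "(\<Sum>t=1..int n. Z (t - int j) \<omega>) - (\<Sum>t=1..int n. Z t \<omega>)
      = (\<Sum>t\<in>?A - ?B. Z t \<omega>) - (\<Sum>t\<in>?B - ?A. Z t \<omega>)" for \<omega>
  proof -
    have "(\<Sum>t=1..int n. Z (t - int j) \<omega>) = (\<Sum>t\<in>?A. Z t \<omega>)"
      by (rule sum.reindex_bij_witness[where i="\<lambda>t. t + int j" and j="\<lambda>t. t - int j"]) auto
    also have "\<dots> = (\<Sum>t\<in>?A \<inter> ?B. Z t \<omega>) + (\<Sum>t\<in>?A - ?B. Z t \<omega>)"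
      by (rule sum.Int_Diff) simp
    finally show ?thesis
      using sum.Int_Diff[of ?B "\<lambda>t. Z t \<omega>" ?A] by (simp add: Int_commute)
  qed
  then have "expectation (\<lambda>\<omega>. \<bar>(\<Sum>t=1..int n. Z (t - int j) \<omega>) - (\<Sum>t=1..int n. Z t \<omega>)\<bar>)
      \<le> expectation (\<lambda>\<omega>. \<bar>\<Sum>t\<in>?A - ?B. Z t \<omega>\<bar> + \<bar>\<Sum>t\<in>?B - ?A. Z t \<omega>\<bar>)"
    using intZ by (intro integral_mono) auto
  also have "\<dots> = expectation (\<lambda>\<omega>. \<bar>\<Sum>t\<in>?A - ?B. Z t \<omega>\<bar>) + expectation (\<lambda>\<omega>. \<bar>\<Sum>t\<in>?B - ?A. Z t \<omega>\<bar>)"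
    using intZ by (intro Bochner_Integration.integral_add) auto
  also have "\<dots> \<le> 2 * (sqrt (m * U b) + 2 * m * V b)"
    using expectation_abs_sum_le[of "?A - ?B" b] expectation_abs_sum_le[of "?B - ?A" b] assms(1)
    unfolding card m_def by simp
  finally show ?thesis .
qed

end

section \<open>The limit law of the partial sums\<close>

locale heavy_linear_process = heavy_iid_process + iid_linear_process
begin

abbreviation "partial_sum_Z n \<omega> \<equiv> (\<Sum>t=1..int n. Z t \<omega>)"

lemma integrable_Z: "integrable M (Z t)"
  using integrable integrable_ident[of "\<lambda>z. z" t] by simp

text \<open>
  Summing the series for \<open>X t\<close> over \<open>t\<close> first leaves, for every lag \<open>j\<close>, the noise summed over a shifted
  block.
\<close>
lemma AE_partial_sum_diff:
  "AE \<omega> in M. partial_sum X n \<omega> - (\<Sum>j. \<psi> j) * partial_sum_Z n \<omega>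
     = (\<Sum>j. \<psi> j * ((\<Sum>t=1..int n. Z (t - int j) \<omega>) - partial_sum_Z n \<omega>))"
proof -
  have "AE \<omega> in M. \<forall>t\<in>{1..int n}. summable (\<lambda>j. \<bar>\<psi> j * Z (t - int j) \<omega>\<bar>)"
    using AE_summable_filter[of "\<lambda>z. z"] integrable by (intro AE_finite_allI) auto
  then show ?thesis
  proof eventually_elim
    case (elim \<omega>)
    then have sm: "summable (\<lambda>j. \<psi> j * Z (t - int j) \<omega>)" if "t \<in> {1..int n}" for t
      using that by (auto intro: summable_rabs_cancel)
    have "partial_sum X n \<omega> = (\<Sum>j. \<Sum>t=1..int n. \<psi> j * Z (t - int j) \<omega>)"
      unfolding partial_sum_def linear_process_def using sm by (intro suminf_sum[symmetric]) auto
    moreover have "(\<Sum>j. \<psi> j) * partial_sum_Z n \<omega> = (\<Sum>j. \<psi> j * partial_sum_Z n \<omega>)"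
      by (rule suminf_mult2[OF summable_\<psi>])
    moreover have "(\<Sum>j. \<Sum>t=1..int n. \<psi> j * Z (t - int j) \<omega>) - (\<Sum>j. \<psi> j * partial_sum_Z n \<omega>)
        = (\<Sum>j. (\<Sum>t=1..int n. \<psi> j * Z (t - int j) \<omega>) - \<psi> j * partial_sum_Z n \<omega>)"
      using sm summable_\<psi> by (intro suminf_diff summable_sum summable_mult2) auto
    ultimately show ?case by (simp add: right_diff_distrib sum_distrib_left)
  qed
qed

end

locale normed_linear_process = heavy_linear_process + centered_norming M "Z 0"
begin

text \<open>
  The mean of lag \<open>j\<close> divided by \<open>b n\<close> tends to 0 for each fixed \<open>j\<close>, since only \<open>j\<close> of the \<open>n\<close> times are not
  shared, and it is bounded uniformly in \<open>j\<close>, since at most \<open>n\<close> are not shared. Absolute summability of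
  the coefficients and Tannery's theorem then give the limit of the series.
\<close>
lemma
  shows partial_sum_diff_integrable: "\<forall>\<^sub>F n in sequentially. integrable M (\<lambda>\<omega>. partial_sum X n \<omega> - (\<Sum>j. \<psi> j) * partial_sum_Z n \<omega>)"
  (is ?int)
    and partial_sum_diff_L1: "(\<lambda>n. expectation (\<lambda>\<omega>. \<bar>partial_sum X n \<omega> - (\<Sum>j. \<psi> j) * partial_sum_Z n \<omega>\<bar>) / b n) \<longlonglongrightarrow> 0"
  (is ?lim)
proof -
  define D where "D n j \<omega> = (\<Sum>t=1..int n. Z (t - int j) \<omega>) - partial_sum_Z n \<omega>" for n j \<omega>
  define e where "e n m = 2 * (sqrt (m * U (b n)) + 2 * m * V (b n)) / b n" for n and m :: real
  have intD: "integrable M (D n j)" for n j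
    unfolding D_def[abs_def] using integrable_Z by auto
  have e_mono: "e n m \<le> e n m'" if "0 \<le> m" "m \<le> m'" "0 < b n" for n m m'
    unfolding e_def using that
    by (intro divide_right_mono mult_left_mono add_mono mult_right_mono)
       (auto intro!: mult_right_mono trunc_moment_nonneg excess_nonneg)
  have ED: "expectation (\<lambda>\<omega>. \<bar>D n j \<omega>\<bar>) / b n \<le> e n (real (min j n))" if "0 < b n" for n j
    using expectation_abs_shifted_sum_le[of "b n" j n] that
    unfolding D_def e_def by (intro divide_right_mono) auto
  have e_eq: "e n m = 2 * (sqrt (m * (U (b n) / (b n)\<^sup>2)) + 2 * m * (V (b n) / b n))" if "0 < b n" for n m
    using that by (simp add: e_def real_sqrt_mult real_sqrt_divide field_simps)
  \<comment> \<open>The uniform bound comes from \<open>m = n\<close>, the limit for a fixed lag from constant \<open>m\<close>.\<close>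
  have e_n: "(\<lambda>n. e n (real n)) \<longlonglongrightarrow> 2 * (sqrt v + 2 * 0)"
  proof -
    have "(\<lambda>n. 2 * (sqrt (real n * U (b n) / (b n)\<^sup>2) + 2 * (real n * V (b n) / b n))) \<longlonglongrightarrow> 2 * (sqrt v + 2 * 0)"
      by (intro tendsto_intros norming norming_excess)
    then show ?thesis
      by (rule Lim_transform_eventually) (use eventually_b_pos in \<open>eventually_elim, simp add: e_eq\<close>)
  qed
  have e_fix: "(\<lambda>n. e n m) \<longlonglongrightarrow> 0" for m
  proof -
    have *: "(\<lambda>n. f n / real n) \<longlonglongrightarrow> 0" if "f \<longlonglongrightarrow> c" for f :: "nat \<Rightarrow> real" and c
      using that by (rule tendsto_divide_0) (rule filterlim_at_top_imp_at_infinity[OF filterlim_real_sequentially])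
    have "(\<lambda>n. 2 * (sqrt (m * (real n * U (b n) / (b n)\<^sup>2 / real n)) + 2 * m * (real n * V (b n) / b n / real n)))
       \<longlonglongrightarrow> 2 * (sqrt (m * 0) + 2 * m * 0)"
      by (intro tendsto_intros *[OF norming] *[OF norming_excess])
    then have "(\<lambda>n. e n m) \<longlonglongrightarrow> 2 * (sqrt (m * 0) + 2 * m * 0)"
      by (rule Lim_transform_eventually)
         (use eventually_b_pos eventually_gt_at_top[of 0] in \<open>eventually_elim, simp add: e_eq\<close>)
    then show ?thesis by simp
  qed
  define a where "a j n = \<bar>\<psi> j\<bar> * (expectation (\<lambda>\<omega>. \<bar>D n j \<omega>\<bar>) / b n)" for j n
  define K where "K = 2 * sqrt v + 1"
  have ev: "\<forall>\<^sub>F n in sequentially. 0 < b n \<and> e n (real n) \<le> K"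
  proof -
    have "\<forall>\<^sub>F n in sequentially. e n (real n) < K"
      by (rule order_tendstoD(2)[OF e_n]) (simp add: K_def)
    with eventually_b_pos show ?thesis by eventually_elim simp
  qed
  have a_bound: "norm (a j n) \<le> \<bar>\<psi> j\<bar> * K" if "0 < b n \<and> e n (real n) \<le> K" for j n
  proof -
    have "expectation (\<lambda>\<omega>. \<bar>D n j \<omega>\<bar>) / b n \<le> K"
      using ED[of n j] e_mono[of "real (min j n)" "real n" n] that by simp
    moreover have "0 \<le> expectation (\<lambda>\<omega>. \<bar>D n j \<omega>\<bar>) / b n" using that by simp
    ultimately show ?thesis unfolding a_def real_norm_def abs_mult abs_idempotent
      by (intro mult_left_mono) auto
  qed
  have tan: "\<forall>\<^sub>F n in sequentially. summable (\<lambda>j. norm (a j n))" "(\<lambda>n. \<Sum>j. a j n) \<longlonglongrightarrow> (\<Sum>j. 0)"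
  proof -
    have "\<forall>\<^sub>F n in sequentially. summable (\<lambda>j. norm (a j n)) \<and> True"
      using ev
    proof eventually_elim
      case (elim n)
      show ?case using a_bound[OF elim] summable_mult2[OF summable_abs, of K]
        by (auto intro: summable_comparison_test')
    qed
    then show "\<forall>\<^sub>F n in sequentially. summable (\<lambda>j. norm (a j n))" by simp
    have lim: "(\<lambda>n. a j n) \<longlonglongrightarrow> 0" for j
    proof (rule tendsto_sandwich[OF _ _ tendsto_const])
      show "\<forall>\<^sub>F n in sequentially. 0 \<le> a j n"
        using eventually_b_pos by eventually_elim (simp add: a_def)
      show "\<forall>\<^sub>F n in sequentially. a j n \<le> \<bar>\<psi> j\<bar> * e n (real j)"
        using eventually_b_pos
      proof eventually_elim
        case (elim n)
        have "expectation (\<lambda>\<omega>. \<bar>D n j \<omega>\<bar>) / b n \<le> e n (real j)"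
          using ED[of n j] e_mono[of "real (min j n)" "real j" n] elim by simp
        then show ?case unfolding a_def by (intro mult_left_mono) auto
      qed
      show "(\<lambda>n. \<bar>\<psi> j\<bar> * e n (real j)) \<longlonglongrightarrow> 0"
        using tendsto_mult[OF tendsto_const e_fix] by simp
    qed
    have "\<forall>\<^sub>F (j, n) in at_top \<times>\<^sub>F sequentially. norm (a j n) \<le> \<bar>\<psi> j\<bar> * K"
      unfolding eventually_prod_filter using ev a_bound
      by (intro exI[of _ "\<lambda>_. True"] exI[of _ "\<lambda>n. 0 < b n \<and> e n (real n) \<le> K"]) auto
    then show "(\<lambda>n. \<Sum>j. a j n) \<longlonglongrightarrow> (\<Sum>j. 0)"
      using tannerys_theorem[OF lim _ summable_mult2[OF summable_abs, of K]] by simp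
  qed
  let ?P = "\<lambda>n \<omega>. partial_sum X n \<omega> - (\<Sum>j. \<psi> j) * partial_sum_Z n \<omega>"
  have main: "integrable M (?P n) \<and> expectation (\<lambda>\<omega>. \<bar>?P n \<omega>\<bar>) / b n \<le> (\<Sum>j. a j n)"
    if "summable (\<lambda>j. norm (a j n))" "0 < b n" for n
  proof -
    have eqa: "expectation (\<lambda>\<omega>. \<bar>\<psi> j * D n j \<omega>\<bar>) = a j n * b n" for j
      using that by (simp add: a_def abs_mult)
    have sm: "summable (\<lambda>j. a j n)" using that(1) by (auto intro: summable_norm_cancel)
    then have sm': "summable (\<lambda>j. expectation (\<lambda>\<omega>. \<bar>\<psi> j * D n j \<omega>\<bar>))"
      unfolding eqa by (rule summable_mult2)
    have int': "integrable M (\<lambda>\<omega>. \<psi> j * D n j \<omega>)" for j using intD by simp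
    have AE: "AE \<omega> in M. ?P n \<omega> = (\<Sum>j. \<psi> j * D n j \<omega>)"
      using AE_partial_sum_diff[of n] by (simp add: D_def)
    have [measurable]: "D n j \<in> borel_measurable M" for j using intD[of n j] by simp
    have "integrable M (?P n)"
      by (rule iffD2[OF integrable_cong_AE[OF _ _ AE] integrable_suminf_L1[OF int' sm']]) measurable
    moreover have "expectation (\<lambda>\<omega>. \<bar>?P n \<omega>\<bar>) = expectation (\<lambda>\<omega>. \<bar>\<Sum>j. \<psi> j * D n j \<omega>\<bar>)"
      using AE by (intro integral_cong_AE) auto
    then have "expectation (\<lambda>\<omega>. \<bar>?P n \<omega>\<bar>) \<le> (\<Sum>j. a j n * b n)"
      using integral_abs_suminf_le[OF int' sm'] by (simp add: eqa)
    then have "expectation (\<lambda>\<omega>. \<bar>?P n \<omega>\<bar>) \<le> (\<Sum>j. a j n) * b n"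
      using suminf_mult2[OF sm, of "b n"] by simp
    ultimately show ?thesis using that by (simp add: pos_divide_le_eq)
  qed
  have ev2: "\<forall>\<^sub>F n in sequentially. integrable M (?P n) \<and> expectation (\<lambda>\<omega>. \<bar>?P n \<omega>\<bar>) / b n \<le> (\<Sum>j. a j n)"
    using tan(1) eventually_b_pos by eventually_elim (rule main)
  then show ?int by eventually_elim simp
  show ?lim
  proof (rule tendsto_sandwich[OF _ _ tendsto_const])
    show "\<forall>\<^sub>F n in sequentially. 0 \<le> expectation (\<lambda>\<omega>. \<bar>?P n \<omega>\<bar>) / b n"
      using eventually_b_pos by eventually_elim simp
    show "\<forall>\<^sub>F n in sequentially. expectation (\<lambda>\<omega>. \<bar>?P n \<omega>\<bar>) / b n \<le> (\<Sum>j. a j n)"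
      using ev2 by eventually_elim simp
    show "(\<lambda>n. \<Sum>j. a j n) \<longlonglongrightarrow> 0" using tan(2) by simp
  qed
qed

text \<open>
  Characteristic functions are 1-Lipschitz in \<open>L\<^sup>1\<close> up to the factor \<open>\<bar>t\<bar>\<close>, so those of the partial sums have
  the same limits as those of the multiples of the iid sums. This includes the degenerate case in which the
  coefficients sum to 0.
\<close>
lemma partial_sum_weak_limit:
  "weak_conv_m (\<lambda>n. distr M borel (\<lambda>\<omega>. partial_sum X n \<omega> / b n))
     (normal_distribution 0 (v * (\<Sum>j. \<psi> j)\<^sup>2))"
proof (rule levy_continuity)
  let ?s = "\<Sum>j. \<psi> j"
  show "real_distribution (distr M borel (\<lambda>\<omega>. partial_sum X n \<omega> / b n))" for n
    by (rule real_distribution_distr) measurable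
  have vs: "0 \<le> v * ?s\<^sup>2" using v_nonneg by simp
  then show "real_distribution (normal_distribution 0 (v * ?s\<^sup>2))" by (rule real_distribution_normal)
  fix t
  let ?P = "\<lambda>n \<omega>. partial_sum X n \<omega> - ?s * partial_sum_Z n \<omega>"
  let ?c = "\<lambda>n. char (distr M borel (\<lambda>\<omega>. partial_sum X n \<omega> / b n)) t"
  let ?d = "\<lambda>n. char (distr M borel (partial_sum_Z n)) (t * ?s / b n)"
  have d: "?d n = char (distr M borel (Z 0)) (t * ?s / b n) ^ n" for n
    using char_sum_iid[of "{1..int n}"] by simp
  have "?d \<longlonglongrightarrow> of_real (exp (- (v * (t * ?s)\<^sup>2) / 2))"
    unfolding d by (rule char_scaled_power_limit)
  then have dlim: "?d \<longlonglongrightarrow> char (normal_distribution 0 (v * ?s\<^sup>2)) t"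
    unfolding char_normal_distribution[OF vs] by (simp add: power_mult_distrib mult_ac)
  have bound: "\<forall>\<^sub>F n in sequentially. cmod (?c n - ?d n)
      \<le> \<bar>t\<bar> * (expectation (\<lambda>\<omega>. \<bar>?P n \<omega>\<bar>) / b n)"
    using partial_sum_diff_integrable eventually_b_pos
  proof eventually_elim
    case (elim n)
    let ?x = "\<lambda>\<omega>. t * (partial_sum X n \<omega> / b n)" and ?y = "\<lambda>\<omega>. t * ?s / b n * partial_sum_Z n \<omega>"
    have ix: "integrable M (\<lambda>\<omega>. iexp (?x \<omega>))" "integrable M (\<lambda>\<omega>. iexp (?y \<omega>))"
      using integrable_iexp[of "\<lambda>\<omega>. complex_of_real (?x \<omega>)"]
        integrable_iexp[of "\<lambda>\<omega>. complex_of_real (?y \<omega>)"] by (simp_all del: of_real_mult of_real_divide)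
    have "?c n = (CLINT \<omega>|M. iexp (?x \<omega>))" "?d n = (CLINT \<omega>|M. iexp (?y \<omega>))"
      by (simp_all add: char_def integral_distr del: of_real_mult of_real_divide)
    then have "cmod (?c n - ?d n) = cmod (CLINT \<omega>|M. iexp (?x \<omega>) - iexp (?y \<omega>))"
      using ix by (simp del: of_real_mult of_real_divide)
    also have "\<dots> \<le> expectation (\<lambda>\<omega>. cmod (iexp (?x \<omega>) - iexp (?y \<omega>)))"
      by (rule integral_norm_bound)
    also have "\<dots> \<le> expectation (\<lambda>\<omega>. \<bar>t\<bar> / b n * \<bar>?P n \<omega>\<bar>)"
    proof (rule integral_mono)
      fix \<omega>
      have "iexp (?x \<omega>) - iexp (?y \<omega>) = iexp (?y \<omega>) * (iexp (?x \<omega> - ?y \<omega>) - 1)"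
        by (simp add: right_diff_distrib exp_add[symmetric] del: of_real_mult of_real_divide)
      then have "cmod (iexp (?x \<omega>) - iexp (?y \<omega>)) = cmod (iexp (?x \<omega> - ?y \<omega>) - 1)"
        by (simp add: norm_mult del: of_real_mult of_real_divide)
      also have "\<dots> \<le> \<bar>?x \<omega> - ?y \<omega>\<bar>" using iexp_approx1[of "?x \<omega> - ?y \<omega>" 0] by simp
      also have "?x \<omega> - ?y \<omega> = t / b n * ?P n \<omega>" by (simp add: diff_divide_distrib right_diff_distrib)
      finally show "cmod (iexp (?x \<omega>) - iexp (?y \<omega>)) \<le> \<bar>t\<bar> / b n * \<bar>?P n \<omega>\<bar>"
        using elim by (simp add: abs_mult)
    qed (use elim ix in auto)
    also have "\<dots> = \<bar>t\<bar> * (expectation (\<lambda>\<omega>. \<bar>?P n \<omega>\<bar>) / b n)" by simp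
    finally show ?case .
  qed
  have "(\<lambda>n. \<bar>t\<bar> * (expectation (\<lambda>\<omega>. \<bar>?P n \<omega>\<bar>) / b n)) \<longlonglongrightarrow> 0"
    using tendsto_mult[OF tendsto_const partial_sum_diff_L1] by simp
  then have "(\<lambda>n. ?c n - ?d n) \<longlonglongrightarrow> 0" by (rule Lim_null_comparison[OF bound])
  from tendsto_add[OF this dlim]
  show "?c \<longlonglongrightarrow> char (normal_distribution 0 (v * ?s\<^sup>2)) t" by simp
qed

end

section \<open>The truncated second moment of the linear process\<close>

context linear_filter
begin

lemma abs_le_suminf: "\<bar>\<psi> j\<bar> \<le> (\<Sum>j. \<bar>\<psi> j\<bar>)"
  using sum_le_suminf[OF summable_abs, of "{j}"] by simp

lemma summable_sq: "summable (\<lambda>j. (\<psi> j)\<^sup>2)"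
proof (rule summable_comparison_test')
  show "summable (\<lambda>j. (\<Sum>j. \<bar>\<psi> j\<bar>) * \<bar>\<psi> j\<bar>)" by (intro summable_mult summable_abs)
  show "norm ((\<psi> j)\<^sup>2) \<le> (\<Sum>j. \<bar>\<psi> j\<bar>) * \<bar>\<psi> j\<bar>" if "0 \<le> j" for j
    using mult_right_mono[OF abs_le_suminf[of j], of "\<bar>\<psi> j\<bar>"] by (simp add: power2_eq_square)
qed

end

context heavy_linear_process
begin

definition clipped_filter :: "real \<Rightarrow> 'a \<Rightarrow> real" where
  "clipped_filter x \<omega> = (\<Sum>j. \<psi> j * clip x (Z (0 - int j) \<omega>))"

lemma measurable_clipped_filter [measurable]: "clipped_filter x \<in> borel_measurable M"
  unfolding clipped_filter_def[abs_def] by measurable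

lemma summable_clipped_abs:
  assumes "0 \<le> x"
  shows "summable (\<lambda>j. \<bar>\<psi> j * clip x (Z (0 - int j) \<omega>)\<bar>)"
proof (rule summable_comparison_test')
  show "summable (\<lambda>j. \<bar>\<psi> j\<bar> * x)" by (intro summable_mult2 summable_abs)
  show "norm \<bar>\<psi> j * clip x (Z (0 - int j) \<omega>)\<bar> \<le> \<bar>\<psi> j\<bar> * x" if "0 \<le> j" for j
    using assms by (simp add: abs_mult abs_clip mult_left_mono)
qed

text \<open>
  Finite partial sums are bounded by a constant, so the formula for them passes to the limit by
  dominated convergence.
\<close>
lemma clipped_filter_second_moment:
  assumes "0 \<le> x"
  defines "m \<equiv> expectation (\<lambda>\<omega>. clip x (Z 0 \<omega>))"
  shows "expectation (\<lambda>\<omega>. (clipped_filter x \<omega>)\<^sup>2)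
      = (\<Sum>j. (\<psi> j)\<^sup>2) * (U x - m\<^sup>2) + (\<Sum>j. \<psi> j)\<^sup>2 * m\<^sup>2"
    and "integrable M (\<lambda>\<omega>. (clipped_filter x \<omega>)\<^sup>2)"
proof -
  let ?c = "\<lambda>j \<omega>. \<psi> j * clip x (Z (0 - int j) \<omega>)"
  let ?s = "\<lambda>q \<omega>. (\<Sum>j<q. ?c j \<omega>)\<^sup>2"
  let ?B = "((\<Sum>j. \<bar>\<psi> j\<bar>) * x)\<^sup>2"
  have lim: "(\<lambda>q. ?s q \<omega>) \<longlonglongrightarrow> (clipped_filter x \<omega>)\<^sup>2" for \<omega>
    unfolding clipped_filter_def
    by (intro tendsto_power summable_LIMSEQ summable_rabs_cancel[OF summable_clipped_abs] assms)
  have bound: "norm (?s q \<omega>) \<le> ?B" for q \<omega>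
  proof -
    have "\<bar>\<Sum>j<q. ?c j \<omega>\<bar> \<le> (\<Sum>j<q. \<bar>\<psi> j\<bar> * x)"
      using assms by (intro order_trans[OF sum_abs] sum_mono) (auto simp: abs_mult abs_clip intro!: mult_left_mono)
    also have "\<dots> = (\<Sum>j<q. \<bar>\<psi> j\<bar>) * x" by (rule sum_distrib_right[symmetric])
    also have "\<dots> \<le> (\<Sum>j. \<bar>\<psi> j\<bar>) * x"
      using assms by (intro mult_right_mono sum_le_suminf summable_abs) auto
    finally have "\<bar>\<Sum>j<q. ?c j \<omega>\<bar>\<^sup>2 \<le> ?B" by (intro power_mono) auto
    then show ?thesis by simp
  qed
  have "(\<lambda>q. expectation (?s q)) \<longlonglongrightarrow> expectation (\<lambda>\<omega>. (clipped_filter x \<omega>)\<^sup>2)"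
    by (rule integral_dominated_convergence[where w="\<lambda>_. ?B"]) (use lim bound in auto)
  moreover have "expectation (?s q) = (\<Sum>j<q. (\<psi> j)\<^sup>2) * (U x - m\<^sup>2) + (\<Sum>j<q. \<psi> j)\<^sup>2 * m\<^sup>2" for q
    unfolding m_def trunc_moment_def
    by (rule expectation_weighted_sum_sq(1)) (use assms in \<open>auto simp: inj_on_def integrable_clip_sq\<close>)
  moreover have "(\<lambda>q. (\<Sum>j<q. (\<psi> j)\<^sup>2) * (U x - m\<^sup>2) + (\<Sum>j<q. \<psi> j)\<^sup>2 * m\<^sup>2)
      \<longlonglongrightarrow> (\<Sum>j. (\<psi> j)\<^sup>2) * (U x - m\<^sup>2) + (\<Sum>j. \<psi> j)\<^sup>2 * m\<^sup>2"
    by (intro tendsto_intros summable_LIMSEQ summable_sq summable_\<psi>)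
  ultimately show "expectation (\<lambda>\<omega>. (clipped_filter x \<omega>)\<^sup>2)
      = (\<Sum>j. (\<psi> j)\<^sup>2) * (U x - m\<^sup>2) + (\<Sum>j. \<psi> j)\<^sup>2 * m\<^sup>2"
    using LIMSEQ_unique by fastforce
  have "norm ((clipped_filter x \<omega>)\<^sup>2) \<le> ?B" for \<omega>
    by (rule tendsto_upperbound[OF tendsto_norm[OF lim]]) (use bound in auto)
  then show "integrable M (\<lambda>\<omega>. (clipped_filter x \<omega>)\<^sup>2)"
    by (intro integrable_const_bound[where B="?B"]) auto
qed

text \<open>
  Clipping the process and filtering the clipped noise differ in two ways. First, \<open>X\<close> and the filtered
  clipped noise \<open>V\<close> differ by the filtered clipped off parts, and squares of numbers clipped at \<open>x\<close> are Lipschitz with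
  constant \<open>2 * x\<close>. Second, \<open>V\<close> itself may leave \<open>[-x, x]\<close>. As \<open>C\<close> dominates the sum of the \<open>\<bar>\<psi> j\<bar>\<close>, this
  requires some noise variable to exceed \<open>x / C\<close> in absolute value, and the overshoot is at most \<open>x\<close> times the sum of the
  \<open>\<bar>\<psi> j\<bar>\<close> over the lags where this happens; the factor \<open>\<bar>V\<bar> + x\<close> that turns the overshoot into a difference of
  squares is at most \<open>(C + 1) * x\<close>. Both errors are sums over single lags, so their means reduce to
  the excess and the tail of one noise variable.
\<close>
lemma clip_linear_process_approx:
  assumes "0 < x" and C: "1 \<le> C" "(\<Sum>j. \<bar>\<psi> j\<bar>) \<le> C"
  defines "h \<equiv> \<lambda>z. 2 * x * \<bar>z - clip x z\<bar> + (C + 1) * x\<^sup>2 * indicator {y. \<bar>y\<bar> > x / C} z"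
  shows "AE \<omega> in M. \<bar>(clip x (X 0 \<omega>))\<^sup>2 - (clipped_filter x \<omega>)\<^sup>2\<bar> \<le> (\<Sum>j. \<bar>\<psi> j * h (Z (0 - int j) \<omega>)\<bar>)"
proof -
  have [measurable]: "{y::real. \<bar>y\<bar> > x / C} \<in> sets borel" by measurable
  have "AE \<omega> in M. summable (\<lambda>j. \<bar>\<psi> j * Z (0 - int j) \<omega>\<bar>)"
    using AE_summable_filter[of "\<lambda>z. z" 0] integrable by simp
  then show ?thesis
  proof eventually_elim
    case (elim \<omega>)
    let ?Z = "\<lambda>j. Z (0 - int j) \<omega>"
    let ?X = "X 0 \<omega>" and ?V = "clipped_filter x \<omega>"
    define r where "r j = \<bar>\<psi> j\<bar> * \<bar>?Z j - clip x (?Z j)\<bar>" for j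
    define u where "u j = \<bar>\<psi> j\<bar> * indicator {y. \<bar>y\<bar> > x / C} (?Z j)" for j
    have smc: "summable (\<lambda>j. \<bar>\<psi> j * clip x (?Z j)\<bar>)"
      using assms by (intro summable_clipped_abs) simp
    have smr: "summable r"
    proof (rule summable_comparison_test'[OF elim])
      show "norm (r j) \<le> \<bar>\<psi> j * ?Z j\<bar>" if "0 \<le> j" for j
        using assms by (simp add: r_def abs_mult abs_diff_clip mult_left_mono)
    qed
    have smu: "summable u"
      by (rule summable_comparison_test'[OF summable_abs]) (simp add: u_def indicator_def)
    have XV: "\<bar>?X - ?V\<bar> \<le> (\<Sum>j. r j)"
    proof -
      have "?X - ?V = (\<Sum>j. \<psi> j * ?Z j - \<psi> j * clip x (?Z j))"
        unfolding linear_process_def clipped_filter_def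
        by (intro suminf_diff summable_rabs_cancel[OF elim] summable_rabs_cancel[OF smc])
      also have "\<bar>\<dots>\<bar> \<le> (\<Sum>j. \<bar>\<psi> j * ?Z j - \<psi> j * clip x (?Z j)\<bar>)"
        using smr by (intro summable_rabs) (simp add: r_def[abs_def] abs_mult[symmetric] right_diff_distrib)
      also have "\<dots> = (\<Sum>j. r j)" by (simp add: r_def abs_mult[symmetric] right_diff_distrib)
      finally show ?thesis .
    qed
    have "\<bar>(clip x ?X)\<^sup>2 - (clip x ?V)\<^sup>2\<bar> = \<bar>clip x ?X + clip x ?V\<bar> * \<bar>clip x ?X - clip x ?V\<bar>"
      by (simp add: power2_eq_square abs_mult[symmetric] algebra_simps)
    also have "\<dots> \<le> (2 * x) * (\<Sum>j. r j)"
    proof (intro mult_mono)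
      show "\<bar>clip x ?X + clip x ?V\<bar> \<le> 2 * x"
        using abs_clip[of x ?X] abs_clip[of x ?V] assms(1) by simp
      show "\<bar>clip x ?X - clip x ?V\<bar> \<le> (\<Sum>j. r j)" using abs_clip_diff_le XV by (rule order_trans)
    qed (use assms in auto)
    finally have part1: "\<bar>(clip x ?X)\<^sup>2 - (clip x ?V)\<^sup>2\<bar> \<le> 2 * x * (\<Sum>j. r j)" .
    have V1: "\<bar>?V\<bar> \<le> (\<Sum>j. \<bar>\<psi> j\<bar> * (x / C) + x * u j)"
    proof -
      have "\<bar>?V\<bar> \<le> (\<Sum>j. \<bar>\<psi> j * clip x (?Z j)\<bar>)"
        unfolding clipped_filter_def by (rule summable_rabs[OF smc])
      also have "\<dots> \<le> (\<Sum>j. \<bar>\<psi> j\<bar> * (x / C) + x * u j)"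
      proof (rule suminf_le[OF _ smc])
        show "summable (\<lambda>j. \<bar>\<psi> j\<bar> * (x / C) + x * u j)"
          by (intro summable_add summable_mult summable_mult2 summable_abs smu)
        fix j
        have "0 < x / C" using assms by simp
        then have "\<bar>clip x (?Z j)\<bar> \<le> x / C + x * indicator {y. \<bar>y\<bar> > x / C} (?Z j)"
          using assms(1) by (auto simp: abs_clip split: split_indicator)
        then have "\<bar>\<psi> j\<bar> * \<bar>clip x (?Z j)\<bar> \<le> \<bar>\<psi> j\<bar> * (x / C + x * indicator {y. \<bar>y\<bar> > x / C} (?Z j))"
          by (rule mult_left_mono) simp
        then show "\<bar>\<psi> j * clip x (?Z j)\<bar> \<le> \<bar>\<psi> j\<bar> * (x / C) + x * u j"
          by (simp add: abs_mult u_def algebra_simps)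
      qed
      finally show ?thesis .
    qed
    have split: "(\<Sum>j. \<bar>\<psi> j\<bar> * (x / C) + x * u j) = (\<Sum>j. \<bar>\<psi> j\<bar>) * (x / C) + x * (\<Sum>j. u j)"
      using smu summable_abs
      by (simp add: suminf_add[symmetric] summable_mult summable_mult2 suminf_mult suminf_mult2[symmetric] del: times_divide_eq_right)
    have u0: "0 \<le> (\<Sum>j. u j)" by (intro suminf_nonneg smu) (simp add: u_def)
    have "(\<Sum>j. \<bar>\<psi> j\<bar>) * (x / C) \<le> C * (x / C)"
      using assms by (intro mult_right_mono) auto
    then have V2: "\<bar>?V\<bar> \<le> x + x * (\<Sum>j. u j)" using V1 C unfolding split by simp
    have "(\<Sum>j. u j) \<le> (\<Sum>j. \<bar>\<psi> j\<bar>)"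
      by (intro suminf_le smu summable_abs) (simp add: u_def indicator_def)
    have V3: "\<bar>?V\<bar> \<le> C * x"
    proof -
      have "\<bar>?V\<bar> \<le> (\<Sum>j. \<bar>\<psi> j * clip x (?Z j)\<bar>)"
        unfolding clipped_filter_def by (rule summable_rabs[OF smc])
      also have "\<dots> \<le> (\<Sum>j. \<bar>\<psi> j\<bar> * x)"
        using assms(1) by (intro suminf_le smc summable_mult2 summable_abs) (simp add: abs_mult abs_clip mult_left_mono)
      also have "\<dots> = (\<Sum>j. \<bar>\<psi> j\<bar>) * x" by (rule suminf_mult2[OF summable_abs, symmetric])
      also have "\<dots> \<le> C * x" using assms by (intro mult_right_mono) auto
      finally show ?thesis .
    qed
    have part2: "\<bar>(clip x ?V)\<^sup>2 - ?V\<^sup>2\<bar> \<le> (C + 1) * x\<^sup>2 * (\<Sum>j. u j)"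
    proof (cases "\<bar>?V\<bar> \<le> x")
      case True
      then show ?thesis using u0 C by (simp add: clip_sq min_def)
    next
      case False
      have "\<bar>(clip x ?V)\<^sup>2 - ?V\<^sup>2\<bar> = \<bar>?V\<bar>\<^sup>2 - x\<^sup>2"
        using False assms(1) power_mono[of x "\<bar>?V\<bar>" 2] by (simp add: clip_sq min_def)
      also have "\<dots> = (\<bar>?V\<bar> + x) * (\<bar>?V\<bar> - x)" by (simp add: power2_eq_square algebra_simps)
      also have "\<dots> \<le> ((C + 1) * x) * (x * (\<Sum>j. u j))"
        using V2 V3 False assms(1) C by (intro mult_mono) (auto simp: algebra_simps)
      finally show ?thesis by (simp add: power2_eq_square mult_ac)
    qed
    have "(\<Sum>j. \<bar>\<psi> j * h (?Z j)\<bar>) = (\<Sum>j. 2 * x * r j + (C + 1) * x\<^sup>2 * u j)"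
    proof (intro suminf_cong)
      fix j
      have "0 \<le> h (?Z j)" using assms by (simp add: h_def)
      then have "\<bar>\<psi> j * h (?Z j)\<bar> = \<bar>\<psi> j\<bar> * h (?Z j)" by (simp only: abs_mult abs_of_nonneg)
      then show "\<bar>\<psi> j * h (?Z j)\<bar> = 2 * x * r j + (C + 1) * x\<^sup>2 * u j"
        by (simp only:) (simp add: h_def r_def u_def algebra_simps)
    qed
    also have "\<dots> = 2 * x * (\<Sum>j. r j) + (C + 1) * x\<^sup>2 * (\<Sum>j. u j)"
      by (simp only: suminf_add[symmetric] suminf_mult summable_mult smr smu)
    finally show ?case using part1 part2 by linarith
  qed
qed

lemma trunc_moment_linear_process_approx:
  assumes "0 < x" and C: "1 \<le> C" "(\<Sum>j. \<bar>\<psi> j\<bar>) \<le> C"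
  shows "\<bar>trunc_moment M (X 0) x - expectation (\<lambda>\<omega>. (clipped_filter x \<omega>)\<^sup>2)\<bar>
    \<le> (\<Sum>j. \<bar>\<psi> j\<bar>) * (2 * (x * V x) + (C + 1) * (x\<^sup>2 * G (x / C)))"
proof -
  define h where "h z = 2 * x * \<bar>z - clip x z\<bar> + (C + 1) * x\<^sup>2 * indicator {y. \<bar>y\<bar> > x / C} z" for z
  have [measurable]: "{y::real. \<bar>y\<bar> > x / C} \<in> sets borel" by measurable
  have [measurable]: "h \<in> borel_measurable borel" unfolding h_def[abs_def] by measurable
  have h0: "0 \<le> h z" for z using assms by (simp add: h_def)
  have inth: "integrable M (\<lambda>\<omega>. h (Z t \<omega>))" for t
    unfolding h_def using integrable_excess[OF integrable_Z, of x t] assms(1)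
    by (intro Bochner_Integration.integrable_add integrable_mult_right integrable_tail_indicator) auto
  have Eh: "expectation (\<lambda>\<omega>. \<bar>h (Z 0 \<omega>)\<bar>) = 2 * (x * V x) + (C + 1) * (x\<^sup>2 * G (x / C))"
    using h0 integrable_excess[OF integrable_Z, of x 0] assms(1)
    by (simp add: h_def excess_def tail_prob_eq_expectation)
  let ?f = "\<lambda>j \<omega>. \<bar>\<psi> j * h (Z (0 - int j) \<omega>)\<bar>"
  have intf: "integrable M (?f j)" for j using inth by simp
  have sm: "summable (\<lambda>j. expectation (\<lambda>\<omega>. \<bar>?f j \<omega>\<bar>))"
    using summable_filtered_expectation(1)[of h 0] by simp
  have intX: "integrable M (\<lambda>\<omega>. (clip x (X 0 \<omega>))\<^sup>2)" using assms by (intro integrable_clip_sq) auto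
  note intV = clipped_filter_second_moment(2)[of x]
  have "\<bar>trunc_moment M (X 0) x - expectation (\<lambda>\<omega>. (clipped_filter x \<omega>)\<^sup>2)\<bar>
      = \<bar>expectation (\<lambda>\<omega>. (clip x (X 0 \<omega>))\<^sup>2 - (clipped_filter x \<omega>)\<^sup>2)\<bar>"
    using intX intV assms(1) by (simp add: trunc_moment_def)
  also have "\<dots> \<le> expectation (\<lambda>\<omega>. \<bar>(clip x (X 0 \<omega>))\<^sup>2 - (clipped_filter x \<omega>)\<^sup>2\<bar>)"
    by (rule integral_abs_bound)
  also have "\<dots> \<le> expectation (\<lambda>\<omega>. \<Sum>j. ?f j \<omega>)"
    using intX intV assms(1) clip_linear_process_approx[OF assms] integrable_suminf_L1[OF intf sm]
    unfolding h_def by (intro integral_mono_AE) auto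
  also have "\<dots> \<le> expectation (\<lambda>\<omega>. \<bar>\<Sum>j. ?f j \<omega>\<bar>)"
    using integrable_suminf_L1[OF intf sm] by (intro integral_mono) auto
  also have "\<dots> \<le> (\<Sum>j. expectation (\<lambda>\<omega>. \<bar>?f j \<omega>\<bar>))"
    by (rule integral_abs_suminf_le[OF intf sm])
  also have "\<dots> = (\<Sum>j. \<bar>\<psi> j\<bar>) * (2 * (x * V x) + (C + 1) * (x\<^sup>2 * G (x / C)))"
    using summable_filtered_expectation(2)[of h 0] Eh by simp
  finally show ?thesis .
qed

text \<open>
  The second moment of the filtered clipped noise is \<open>U x\<close> times the sum of the squared coefficients, up to terms
  with the squared mean of the clipped noise. These stay bounded, while \<open>U\<close> tends to infinity; the
  approximation error is negligible compared with \<open>U\<close> as well.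
\<close>
lemma trunc_moment_linear_process:
  "((\<lambda>x. trunc_moment M (X 0) x / U x) \<longlongrightarrow> (\<Sum>j. (\<psi> j)\<^sup>2)) at_top"
proof -
  define C where "C = 1 + (\<Sum>j. \<bar>\<psi> j\<bar>)"
  have C: "1 \<le> C" "(\<Sum>j. \<bar>\<psi> j\<bar>) \<le> C" by (auto simp: C_def suminf_nonneg[OF summable_abs])
  define m where "m x = expectation (\<lambda>\<omega>. clip x (Z 0 \<omega>))" for x
  let ?E = "\<lambda>x. expectation (\<lambda>\<omega>. (clipped_filter x \<omega>)\<^sup>2)"
  have m2: "((\<lambda>x. (m x)\<^sup>2 / U x) \<longlongrightarrow> 0) at_top"
  proof (rule tendsto_sandwich[OF _ _ tendsto_const])
    let ?B = "expectation (\<lambda>\<omega>. \<bar>Z 0 \<omega>\<bar>)"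
    show "\<forall>\<^sub>F x in at_top. 0 \<le> (m x)\<^sup>2 / U x" by (simp add: trunc_moment_nonneg)
    show "\<forall>\<^sub>F x in at_top. (m x)\<^sup>2 / U x \<le> ?B\<^sup>2 / U x"
      using eventually_ge_at_top[of 0]
    proof eventually_elim
      case (elim x)
      have "\<bar>m x\<bar> \<le> expectation (\<lambda>\<omega>. \<bar>clip x (Z 0 \<omega>)\<bar>)"
        unfolding m_def by (rule integral_abs_bound)
      also have "\<dots> \<le> ?B"
        using elim integrable_Z[of 0] integrable_clip[OF measurable_Z elim, of 0]
        by (intro integral_mono) (auto simp: abs_clip)
      finally have "\<bar>m x\<bar>\<^sup>2 \<le> ?B\<^sup>2" by (rule power_mono) simp
      then show ?case by (intro divide_right_mono trunc_moment_nonneg) simp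
    qed
    show "((\<lambda>x. ?B\<^sup>2 / U x) \<longlongrightarrow> 0) at_top"
      by (intro tendsto_divide_0[OF tendsto_const] filterlim_at_top_imp_at_infinity U_at_top)
  qed
  have "((\<lambda>x. (\<Sum>j. (\<psi> j)\<^sup>2) * (1 - (m x)\<^sup>2 / U x) + (\<Sum>j. \<psi> j)\<^sup>2 * ((m x)\<^sup>2 / U x))
      \<longlongrightarrow> (\<Sum>j. (\<psi> j)\<^sup>2) * (1 - 0) + (\<Sum>j. \<psi> j)\<^sup>2 * 0) at_top"
    by (intro tendsto_intros m2)
  moreover have "\<forall>\<^sub>F x in at_top. (\<Sum>j. (\<psi> j)\<^sup>2) * (1 - (m x)\<^sup>2 / U x) + (\<Sum>j. \<psi> j)\<^sup>2 * ((m x)\<^sup>2 / U x) = ?E x / U x"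
    using eventually_U_pos eventually_ge_at_top[of 0]
    by eventually_elim (simp add: clipped_filter_second_moment(1) m_def[symmetric] field_simps)
  ultimately have lim1: "((\<lambda>x. ?E x / U x) \<longlongrightarrow> (\<Sum>j. (\<psi> j)\<^sup>2)) at_top"
    by (simp add: tendsto_cong)
  have "((\<lambda>x. x\<^sup>2 * G (1 / C * x) / U x) \<longlongrightarrow> 0) at_top"
    using C by (intro scaled_tail_negligible) auto
  then have tail: "((\<lambda>x. x\<^sup>2 * G (x / C) / U x) \<longlongrightarrow> 0) at_top" by simp
  have "((\<lambda>x. (\<Sum>j. \<bar>\<psi> j\<bar>) * (2 * (x * V x / U x) + (C + 1) * (x\<^sup>2 * G (x / C) / U x)))
      \<longlongrightarrow> (\<Sum>j. \<bar>\<psi> j\<bar>) * (2 * 0 + (C + 1) * 0)) at_top"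
    by (intro tendsto_intros excess_negligible tail)
  then have rhs: "((\<lambda>x. (\<Sum>j. \<bar>\<psi> j\<bar>) * (2 * (x * V x / U x) + (C + 1) * (x\<^sup>2 * G (x / C) / U x)))
      \<longlongrightarrow> 0) at_top" by simp
  have "((\<lambda>x. trunc_moment M (X 0) x / U x - ?E x / U x) \<longlongrightarrow> 0) at_top"
  proof (rule Lim_null_comparison[OF _ rhs])
    show "\<forall>\<^sub>F x in at_top. norm (trunc_moment M (X 0) x / U x - ?E x / U x)
        \<le> (\<Sum>j. \<bar>\<psi> j\<bar>) * (2 * (x * V x / U x) + (C + 1) * (x\<^sup>2 * G (x / C) / U x))"
      using eventually_U_pos eventually_gt_at_top[of 0]
    proof eventually_elim
      case (elim x)
      have "norm (trunc_moment M (X 0) x / U x - ?E x / U x) = \<bar>trunc_moment M (X 0) x - ?E x\<bar> / U x"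
        using elim by (simp add: diff_divide_distrib[symmetric])
      also have "\<dots> \<le> (\<Sum>j. \<bar>\<psi> j\<bar>) * (2 * (x * V x) + (C + 1) * (x\<^sup>2 * G (x / C))) / U x"
        using elim by (intro divide_right_mono trunc_moment_linear_process_approx C) auto
      also have "\<dots> = (\<Sum>j. \<bar>\<psi> j\<bar>) * (2 * (x * V x / U x) + (C + 1) * (x\<^sup>2 * G (x / C) / U x))"
        by (simp add: distrib_left add_divide_distrib)
      finally show ?case .
    qed
  qed
  from tendsto_add[OF this lim1] show ?thesis by simp
qed

end

section \<open>Normalizing sequences\<close>

context prob_space
begin

lemma normalizing_seq_trunc_moment:
  assumes [measurable]: "Y \<in> borel_measurable M" and "normalizing_seq M Y a"
  shows "\<forall>\<^sub>F n in sequentially. 0 < a n \<and> real n * trunc_moment M Y (a n) / (a n)\<^sup>2 = 1"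
  using assms(2) unfolding normalizing_seq_def
proof eventually_elim
  case (elim n)
  then have *: "real n * trunc_moment M Y (a n) / (a n)\<^sup>2 = real n * tail_prob M Y (a n)
      + real n / (a n)\<^sup>2 * (\<integral>\<omega>. (Y \<omega>)\<^sup>2 * indicator {y. \<bar>y\<bar> \<le> a n} (Y \<omega>) \<partial>M)"
    by (simp add: trunc_moment_eq field_simps)
  show ?case unfolding * tail_prob_def by (rule elim)
qed

text \<open>
  If \<open>a n\<close> stayed below some \<open>x\<close> for arbitrarily large \<open>n\<close>, then the decreasing function
  \<open>trunc_moment M Y y / y\<^sup>2\<close> would be at least its positive value \<open>r\<close> at \<open>x\<close>, while the equation makes it \<open>1 / n\<close>.
\<close>
lemma normalizing_seq_at_top:
  assumes [measurable]: "Y \<in> borel_measurable M" and a: "normalizing_seq M Y a"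
    and pos: "\<forall>\<^sub>F x in at_top. 0 < trunc_moment M Y x"
  shows "filterlim a at_top sequentially"
  unfolding filterlim_at_top
proof
  fix A :: real
  have "\<forall>\<^sub>F x in at_top. 0 < trunc_moment M Y x \<and> A \<le> x \<and> 0 < x"
    using pos eventually_ge_at_top[of A] eventually_gt_at_top[of 0] by eventually_elim simp
  then obtain x where x: "0 < trunc_moment M Y x" "A \<le> x" "0 < x"
    by (auto simp: eventually_at_top_linorder)
  define r where "r = trunc_moment M Y x / x\<^sup>2"
  have "0 < r" using x by (simp add: r_def)
  obtain N :: nat where N: "1 / r < N" using reals_Archimedean2 by blast
  show "\<forall>\<^sub>F n in sequentially. A \<le> a n"
    using normalizing_seq_trunc_moment[OF assms(1) a] eventually_ge_at_top[of N]
  proof eventually_elim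
    case (elim n)
    show ?case
    proof (rule ccontr)
      assume "\<not> A \<le> a n"
      then have "r \<le> trunc_moment M Y (a n) / (a n)\<^sup>2"
        unfolding r_def using x elim by (intro trunc_moment_div_sq_antimono) auto
      from mult_left_mono[OF this, of "real n"] have "real n * r \<le> 1" using elim by simp
      moreover have "1 / r < real n" using N elim by simp
      ultimately show False using \<open>0 < r\<close> by (simp add: field_simps)
    qed
  qed
qed

end

section \<open>The two central limit theorems\<close>

theorem proposition3p4:
  fixes M :: "'a measure"
    and Z :: "int \<Rightarrow> 'a \<Rightarrow> real"
    and \<psi> :: "nat \<Rightarrow> real"
    and a a\<^sub>Z :: "nat \<Rightarrow> real"
  assumes "prob_space M"
    and "prob_space.indep_vars M (\<lambda>_. borel) Z UNIV"
    and "\<And>t. distr M borel (Z t) = distr M borel (Z 0)"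
    and "regularly_varying_rv M (Z 0) 2"
    and "integrable M (Z 0)"
    and "(\<integral>\<omega>. Z 0 \<omega> \<partial>M) = 0"
    and "(\<integral>\<^sup>+\<omega>. ennreal ((Z 0 \<omega> - (\<integral>\<omega>'. Z 0 \<omega>' \<partial>M))\<^sup>2) \<partial>M) = \<infinity>"
    and "summable (\<lambda>j. \<bar>\<psi> j\<bar>)"
    and "\<psi> 0 = 1"
    and "normalizing_seq M (linear_process \<psi> Z 0) a"
    and "normalizing_seq M (Z 0) a\<^sub>Z"
  shows "weak_conv_m
           (\<lambda>n. distr M borel (\<lambda>\<omega>. partial_sum (linear_process \<psi> Z) n \<omega> / a n))
           (normal_distribution 0 ((\<Sum>j. \<psi> j)\<^sup>2 / (\<Sum>k. (\<psi> k)\<^sup>2)))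
       \<and> weak_conv_m
           (\<lambda>n. distr M borel (\<lambda>\<omega>. partial_sum (linear_process \<psi> Z) n \<omega> / a\<^sub>Z n))
           (normal_distribution 0 ((\<Sum>j. \<psi> j)\<^sup>2))"
proof -
  interpret prob_space M by fact
  have "Z 0 \<in> borel_measurable M" using assms(5) by simp
  interpret heavy_linear_process M Z \<psi>
  proof
    show "((\<lambda>x. x\<^sup>2 * tail_prob M (Z 0) x / trunc_moment M (Z 0) x) \<longlongrightarrow> 0) at_top"
      by (rule regularly_varying_tail_negligible) fact+
    show "(\<integral>\<^sup>+\<omega>. ennreal ((Z 0 \<omega>)\<^sup>2) \<partial>M) = \<infinity>" using assms(6,7) by simp
  qed (fact assms)+
  let ?s = "\<Sum>k. (\<psi> k)\<^sup>2" and ?UX = "trunc_moment M (X 0)"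
  have s: "0 < ?s" using suminf_pos2[OF summable_sq, of 0] assms(9) by simp
  have pos: "\<forall>\<^sub>F x in at_top. 0 < ?UX x"
    using order_tendstoD(1)[OF trunc_moment_linear_process s] eventually_U_pos
    by eventually_elim (simp add: zero_less_divide_iff)
  \<comment> \<open>Both claims are instances with different norming sequences \<open>b\<close>.\<close>
  have limit: "weak_conv_m (\<lambda>n. distr M borel (\<lambda>\<omega>. partial_sum X n \<omega> / b n))
      (normal_distribution 0 (v * (\<Sum>j. \<psi> j)\<^sup>2))"
    if "filterlim b at_top sequentially" "(\<lambda>n. real n * U (b n) / (b n)\<^sup>2) \<longlonglongrightarrow> v" for b v
  proof -
    interpret normed_linear_process M Z \<psi> b v by standard (fact that)+
    show ?thesis by (rule partial_sum_weak_limit)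
  qed
  have a_top: "filterlim a at_top sequentially"
    by (rule normalizing_seq_at_top[OF measurable_linear_process assms(10) pos])
  have "weak_conv_m (\<lambda>n. distr M borel (\<lambda>\<omega>. partial_sum X n \<omega> / a n))
      (normal_distribution 0 (1 / ?s * (\<Sum>j. \<psi> j)\<^sup>2))"
  proof (rule limit[OF a_top])
    have "(\<lambda>n. 1 / (?UX (a n) / U (a n))) \<longlonglongrightarrow> 1 / ?s"
      using s by (intro tendsto_divide tendsto_const filterlim_compose[OF trunc_moment_linear_process a_top]) simp
    moreover have "\<forall>\<^sub>F n in sequentially. 1 / (?UX (a n) / U (a n)) = real n * U (a n) / (a n)\<^sup>2"
      using normalizing_seq_trunc_moment[OF measurable_linear_process assms(10)]
        eventually_compose_filterlim[OF pos a_top] eventually_gt_at_top[of 0]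
      by eventually_elim (simp add: field_simps)
    ultimately show "(\<lambda>n. real n * U (a n) / (a n)\<^sup>2) \<longlonglongrightarrow> 1 / ?s"
      by (rule Lim_transform_eventually)
  qed
  moreover have "weak_conv_m (\<lambda>n. distr M borel (\<lambda>\<omega>. partial_sum X n \<omega> / a\<^sub>Z n))
      (normal_distribution 0 (1 * (\<Sum>j. \<psi> j)\<^sup>2))"
  proof (rule limit)
    show "filterlim a\<^sub>Z at_top sequentially"
      by (rule normalizing_seq_at_top[OF measurable_Z assms(11) eventually_U_pos])
    have "\<forall>\<^sub>F n in sequentially. real n * U (a\<^sub>Z n) / (a\<^sub>Z n)\<^sup>2 = 1"
      using normalizing_seq_trunc_moment[OF measurable_Z assms(11)] by eventually_elim blast
    then show "(\<lambda>n. real n * U (a\<^sub>Z n) / (a\<^sub>Z n)\<^sup>2) \<longlonglongrightarrow> 1" by (rule tendsto_eventually)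
  qed
  ultimately show ?thesis by simp
qed

end
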